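(* Let $m,n,r$ be positive integers with $r<m$ and $r<n$, and let $F:\mathbb{R}^{m\times n}\to\mathbb{R}^{m\times n}$ be continuous and bounded, i.e. there is $B\in\mathbb{R}$ with $\|F(X)\|_F\le B$ for all $X\in\mathbb{R}^{m\times n}$. Let $Y=U\Sigma V^\top$ be a matrix of rank $r$ with $U\in\mathbb{R}^{m\times r}$, $V\in\mathbb{R}^{n\times r}$ having orthonormal columns and $\Sigma\in\mathbb{R}^{r\times r}$. Suppose that QDEIM (with tie-breaking) is used to define the oblique projections $\mathcal{P}^{\angle}$, and let $\mathcal{F}$ be the associated set-valued (Filippov) map. Then $$\mathcal{F}(Y)=\mathrm{conv}\big\{P_{U,S_U}\,F(Y)-P_{U,S_U}\,F(Y)\,P'_{V,S_V}+F(Y)\,P'_{V,S_V}\;\big|\;S_U\in\mathcal{I}_U,\ S_V\in\mathcal{I}_V\big\},$$ where $P_{U,S_U}=U(S_U^\top U)^{-1}S_U^\top$ and $P'_{V,S_V}=S_V(V^\top S_V)^{-1}V^\top$.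
   Context: $\mathcal{M}_r=\{X\in\mathbb{R}^{m\times n}\mid \mathrm{rank}(X)=r\}$; $\|\cdot\|_F$ is the Frobenius norm; $\mathrm{conv}$ is the convex hull and $\overline{\mathrm{conv}}$ its closure. QDEIM with tie-breaking. Input: $U\in\mathbb{R}^{m\times r}$ of full column rank. Set $U^0=U$. For $k=1,\dots,r$: let $p_k$ be the smallest index with $\|U^{k-1}(p_k,:)\|_2=\max_{j}\|U^{k-1}(j,:)\|_2$ (where $U^{k-1}(j,:)$ is the $j$th row); set $u=U^{k-1}(p_k,:)^\top/\|U^{k-1}(p_k,:)\|_2$ and $U^k=U^{k-1}(I-uu^\top)$. Output: the selection matrix $S^{\mathsf Q}_U=[\mathbf e_{p_1},\dots,\mathbf e_{p_r}]\in\mathbb{R}^{m\times r}$, with $\mathbf e_i$ the $i$th unit vector. QDEIM without tie-breaking: the same procedure, except that in each step $p_k$ may be any index attaining the maximal row norm of $U^{k-1}$. $\mathcal{I}_U$ is the set of all selection matrices $[\mathbf e_{p_1},\dots,\mathbf e_{p_r}]$ obtained from all feasible sequences $p_1,\dots,p_r$ of QDEIM without tie-breaking applied to $U$. The same definitions apply to $V\in\mathbb{R}^{n\times r}$ (giving $\mathcal I_V$). For $Y=U\Sigma V^\top\in\mathcal{M}_r$ with $U,V$ having orthonormal columns, the oblique projection is $$\mathcal{P}^{\angle}_Y[Z]=P_U^{\angle}Z-P_U^{\angle}ZP_V^{\vee}+ZP_V^{\vee},\qquad P_U^{\angle}=U(S_U^\top U)^{-1}S_U^\top,\quad P_V^{\vee}=S_V(V^\top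 S_V)^{-1}V^\top,$$ with $S_U=S^{\mathsf Q}_U$, $S_V=S^{\mathsf Q}_V$ (this does not depend on the choice of the orthonormal bases $U,V$). Put $f(Y)=\mathcal{P}^{\angle}_Y[F(Y)]$ for $Y\in\mathcal{M}_r$, $\mathcal{B}=\{X\in\mathbb{R}^{m\times n}:\|X\|_F\le1\}$, and $$\mathcal{F}(Y)=\bigcap_{\epsilon>0}\overline{\mathrm{conv}}\big[f\big((Y+\epsilon\mathcal{B})\cap\mathcal{M}_r\big)\big].$$ *)

theory Defs
  imports "HOL-Analysis.Analysis"
begin

text \<open>
  An \<open>m \<times> n\<close> real matrix is an element of \<^typ>\<open>real ^ 'n ^ 'm\<close>, so its library norm is the Frobenius
  norm. The index types carry a linear order, which supplies ``the smallest index'' and the order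
  of the columns of a selection matrix. QDEIM steps are counted from 0, i.e. \<open>p k\<close> is the pivot
  chosen in step \<open>k + 1\<close>.
\<close>

definition orthonormal_columns :: "real ^ 'r ^ 'm \<Rightarrow> bool" where
  "orthonormal_columns U \<longleftrightarrow> transpose U ** U = mat 1"

definition fixed_rank :: "nat \<Rightarrow> (real ^ 'n ^ 'm) set" where
  "fixed_rank r = {X. rank X = r}"

definition max_rows :: "real ^ 'r ^ 'm \<Rightarrow> 'm set" where
  "max_rows A = {i. norm (row i A) = Max (range (\<lambda>j. norm (row j A)))}"

definition deflate :: "real ^ 'r ^ 'm \<Rightarrow> 'm \<Rightarrow> real ^ 'r ^ 'm" where
  "deflate A i =
    (let u = row i A /\<^sub>R norm (row i A) in
     A ** (mat 1 - (columnvector u :: real ^ 1 ^ 'r) ** rowvector u))"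

primrec qdeim_residual :: "real ^ 'r ^ 'm \<Rightarrow> (nat \<Rightarrow> 'm) \<Rightarrow> nat \<Rightarrow> real ^ 'r ^ 'm" where
  "qdeim_residual U p 0 = U"
| "qdeim_residual U p (Suc k) = deflate (qdeim_residual U p k) (p k)"

text \<open>\<^term>\<open>card {..<j}\<close> is the (zero-based) position of \<open>j\<close> in its linearly ordered index type.\<close>

definition selection_matrix :: "(nat \<Rightarrow> 'm) \<Rightarrow> real ^ 'r::{finite,linorder} ^ 'm" where
  "selection_matrix p = transpose (\<chi> j. axis (p (card {..<j})) 1)"

definition qdeim_feasible :: "real ^ 'r::finite ^ 'm \<Rightarrow> (nat \<Rightarrow> 'm) \<Rightarrow> bool" where
  "qdeim_feasible U p \<longleftrightarrow> (\<forall>k < CARD('r). p k \<in> max_rows (qdeim_residual U p k))"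

definition qdeim_selections ::
    "real ^ 'r::{finite,linorder} ^ 'm \<Rightarrow> (real ^ 'r::{finite,linorder} ^ 'm) set" where
  "qdeim_selections U = {selection_matrix p | p. qdeim_feasible U p}"

primrec qdeim_iterate ::
    "real ^ 'r ^ 'm::{finite,linorder} \<Rightarrow> nat \<Rightarrow> real ^ 'r ^ 'm::{finite,linorder}" where
  "qdeim_iterate U 0 = U"
| "qdeim_iterate U (Suc k) = deflate (qdeim_iterate U k) (Min (max_rows (qdeim_iterate U k)))"

definition qdeim ::
    "real ^ 'r::{finite,linorder} ^ 'm::{finite,linorder}
      \<Rightarrow> real ^ 'r::{finite,linorder} ^ 'm::{finite,linorder}" where
  "qdeim U = selection_matrix (\<lambda>k. Min (max_rows (qdeim_iterate U k)))"

definition column_oblique :: "real ^ 'r ^ 'm \<Rightarrow> real ^ 'r ^ 'm \<Rightarrow> real ^ 'm ^ 'm" where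
  "column_oblique U S = U ** matrix_inv (transpose S ** U) ** transpose S"

definition row_oblique :: "real ^ 'r ^ 'n \<Rightarrow> real ^ 'r ^ 'n \<Rightarrow> real ^ 'n ^ 'n" where
  "row_oblique V S = S ** matrix_inv (transpose V ** S) ** transpose V"

text \<open>
  The oblique projection at a matrix \<open>Y\<close> of rank \<^term>\<open>CARD('r)\<close>. The result does not depend on the
  orthonormal bases: another choice replaces \<open>U\<close> by \<open>U ** Q\<close> with \<open>Q\<close> orthogonal, which changes
  neither row norms, hence \<^term>\<open>qdeim U\<close>, nor \<^term>\<open>column_oblique U (qdeim U)\<close>; likewise for \<open>V\<close>.
\<close>

definition oblique_proj ::
    "'r::{finite,linorder} itself \<Rightarrow> real ^ 'n::{finite,linorder} ^ 'm::{finite,linorder}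
      \<Rightarrow> real ^ 'n::{finite,linorder} ^ 'm::{finite,linorder}
      \<Rightarrow> real ^ 'n::{finite,linorder} ^ 'm::{finite,linorder}" where
  "oblique_proj _ Y Z =
    (let (U, V) =
           (SOME (U :: real ^ 'r::{finite,linorder} ^ 'm::{finite,linorder},
                  V :: real ^ 'r::{finite,linorder} ^ 'n::{finite,linorder}).
             orthonormal_columns U \<and> orthonormal_columns V \<and>
             (\<exists>\<Sigma> :: real ^ 'r::{finite,linorder} ^ 'r::{finite,linorder}. Y = U ** \<Sigma> ** transpose V));
         P = column_oblique U (qdeim U);
         P' = row_oblique V (qdeim V)
     in P ** Z - P ** Z ** P' + Z ** P')"

definition filippov_map ::
    "'r::{finite,linorder} itself
      \<Rightarrow> (real ^ 'n::{finite,linorder} ^ 'm::{finite,linorder}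
          \<Rightarrow> real ^ 'n::{finite,linorder} ^ 'm::{finite,linorder})
      \<Rightarrow> real ^ 'n::{finite,linorder} ^ 'm::{finite,linorder}
      \<Rightarrow> (real ^ 'n::{finite,linorder} ^ 'm::{finite,linorder}) set" where
  "filippov_map r F Y =
    (\<Inter>\<epsilon>\<in>{0<..}. closure (convex hull
       ((\<lambda>X. oblique_proj r X (F X)) ` (cball Y \<epsilon> \<inter> fixed_rank CARD('r)))))"

end

theory Submission
  imports Defs
begin

text \<open>
  For orthonormal \<open>U\<close> with range \<open>R\<close>, the norm of row \<open>j\<close> of the QDEIM residual after the pivots \<open>K\<close>
  is the largest \<open>\<bar>y\<^sub>j\<bar>\<close> among the unit vectors \<open>y \<in> R\<close> that vanish on \<open>K\<close>. So feasibility of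
  a pivot sequence depends on \<open>R\<close> only, and it is a closed condition. Since the pivots range over a
  finite set and orthonormal bases over a compact one, the limit points of \<open>f (X)\<close> as \<open>X \<rightarrow> Y\<close> lie in
  the finite set on the right-hand side, which gives \<open>\<subseteq>\<close>.

  For \<open>\<supseteq>\<close>, every feasible \<open>p\<close> becomes the only feasible sequence for \<open>A R\<close> with \<open>A\<close> close to the
  identity. Scaling coordinate \<open>p\<^sub>k\<close> by a factor that decreases fast enough in \<open>k\<close> breaks all ties,
  except among rows of norm 1, i.e. unit vectors in \<open>R\<close>. These are removed first by tilting \<open>R\<close>
  towards a normal vector \<open>w\<close>; one exists because \<open>r < m\<close>. With \<open>A\<^sub>n, B\<^sub>n \<rightarrow> I\<close> such perturbations for
  the column and row space, \<open>A\<^sub>n Y B\<^sub>n\<^sup>T\<close> tends to \<open>Y\<close> and its image under \<open>f\<close> to the point given by \<open>p\<close>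
  and \<open>q\<close>.
\<close>

subsection \<open>Residual row norms as peaks of a subspace\<close>

text \<open>The unit ball replaces the sphere so that, for a subspace, 0 always qualifies: the
  supremum ranges over a nonempty set and is 0 if no nonzero vector of \<open>R\<close> vanishes on
  \<open>K\<close>.\<close>

definition peak :: "(real ^ 'm) set \<Rightarrow> 'm set \<Rightarrow> 'm \<Rightarrow> real" where
  "peak R K j = (SUP y\<in>{y \<in> R. norm y \<le> 1 \<and> (\<forall>i\<in>K. y $ i = 0)}. \<bar>y $ j\<bar>)"

text \<open>For the range of an orthonormal \<open>U\<close> this is QDEIM feasibility without
  tie-breaking, freed of the choice of basis. Only the values of \<open>p\<close> below
  \<open>r\<close> enter.\<close>

definition greedy :: "(real ^ 'm) set \<Rightarrow> nat \<Rightarrow> (nat \<Rightarrow> 'm) \<Rightarrow> bool" where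
  "greedy R r p \<longleftrightarrow> (\<forall>k<r. \<forall>j. peak R (p ` {..<k}) j \<le> peak R (p ` {..<k}) (p k))"

definition strictly_greedy :: "(real ^ 'm) set \<Rightarrow> nat \<Rightarrow> (nat \<Rightarrow> 'm) \<Rightarrow> bool" where
  "strictly_greedy R r p \<longleftrightarrow>
    (\<forall>k<r. \<forall>j. j \<noteq> p k \<longrightarrow> peak R (p ` {..<k}) j < peak R (p ` {..<k}) (p k))"

lemma peak_bdd: "bdd_above ((\<lambda>y. \<bar>y $ j\<bar>) ` {y \<in> R. norm y \<le> 1 \<and> (\<forall>i\<in>K. y $ i = 0)})"
  for R :: "(real ^ 'm) set"
  by (rule bdd_aboveI[where M = 1]) (auto intro: order_trans[OF component_le_norm_cart])

context
  fixes R :: "(real ^ 'm) set"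
  assumes R: "subspace R"
begin

lemma peak_attained:
  obtains y where "y \<in> R" "norm y \<le> 1" "\<And>i. i \<in> K \<Longrightarrow> y $ i = 0" "\<bar>y $ j\<bar> = peak R K j"
proof -
  let ?S = "{y \<in> R. norm y \<le> 1 \<and> (\<forall>i\<in>K. y $ i = 0)}"
  have "?S = R \<inter> cball 0 1 \<inter> (\<Inter>i\<in>K. {y. y $ i = 0})"
    by auto
  moreover have "closed R"
    using R by (rule closed_subspace)
  moreover have "closed {y :: real ^ 'm. y $ i = 0}" for i
    by (intro closed_Collect_eq continuous_intros)
  ultimately have "compact ?S"
    by (metis (no_types, lifting) closed_INT closed_Int_compact compact_Int_closed compact_cball)
  moreover have "0 \<in> ?S"
    using subspace_0[OF R] by simp
  moreover have "continuous_on ?S (\<lambda>y. \<bar>y $ j\<bar>)"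
    by (intro continuous_intros)
  ultimately obtain y where y: "y \<in> ?S" "\<And>x. x \<in> ?S \<Longrightarrow> \<bar>x $ j\<bar> \<le> \<bar>y $ j\<bar>"
    using continuous_attains_sup[of ?S "\<lambda>y. \<bar>y $ j\<bar>"] by blast
  have "peak R K j = \<bar>y $ j\<bar>"
    unfolding peak_def
    by (intro antisym cSUP_least cSUP_upper peak_bdd) (use y in auto)
  with y that show thesis
    by auto
qed

text \<open>By homogeneity. Together with \<open>peak_leI\<close> it makes the peak the best
  constant in a bound of component \<open>j\<close> by the norm, so later estimates need not
  normalise vectors.\<close>

lemma component_le_peak:
  assumes "y \<in> R" "\<And>i. i \<in> K \<Longrightarrow> y $ i = 0"
  shows "\<bar>y $ j\<bar> \<le> peak R K j * norm y"
proof (cases "y = 0")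
  case False
  have "\<bar>(y /\<^sub>R norm y) $ j\<bar> \<le> peak R K j"
    unfolding peak_def
    by (rule cSUP_upper[OF _ peak_bdd]) (use assms R False in \<open>auto simp: subspace_scale\<close>)
  with False show ?thesis
    by (simp add: divide_simps abs_mult)
qed simp

lemma peak_leI:
  assumes "0 \<le> c" "\<And>y. y \<in> R \<Longrightarrow> (\<And>i. i \<in> K \<Longrightarrow> y $ i = 0) \<Longrightarrow> \<bar>y $ j\<bar> \<le> c * norm y"
  shows "peak R K j \<le> c"
proof -
  obtain y where y: "y \<in> R" "norm y \<le> 1" "\<And>i. i \<in> K \<Longrightarrow> y $ i = 0" "\<bar>y $ j\<bar> = peak R K j"
    using peak_attained[of K j] by blast
  then have "peak R K j \<le> c * norm y"
    using assms(2)[of y] by simp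
  also have "\<dots> \<le> c"
    using mult_left_mono[OF y(2) assms(1)] by simp
  finally show ?thesis .
qed

lemma peak_nonneg: "0 \<le> peak R K j"
  by (metis abs_ge_zero peak_attained)

lemma peak_le_1: "peak R K j \<le> 1"
  using component_le_norm_cart by (intro peak_leI) auto

lemma peak_eq_0: "j \<in> K \<Longrightarrow> peak R K j = 0"
  using peak_nonneg[of K j] peak_leI[of 0 K j] by auto

lemma peak_axis:
  assumes "axis j 1 \<in> R" "j \<notin> K"
  shows "peak R K j = 1"
proof -
  have "axis j (1::real) $ i = 0" if "i \<in> K" for i
    using assms(2) that by (auto simp: axis_def)
  then have "\<bar>axis j 1 $ j\<bar> \<le> peak R K j * norm (axis j (1::real))"
    using assms(1) by (intro component_le_peak) auto
  then show ?thesis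
    using peak_le_1[of K j] by simp
qed

text \<open>A vector of norm at most 1 with a component of absolute value 1 has no room for other
  components, so it is plus or minus that unit vector.\<close>

lemma peak_eq_1_imp_axis:
  assumes "peak R K j = 1"
  shows "axis j 1 \<in> R"
proof -
  obtain y where y: "y \<in> R" "norm y \<le> 1" "\<bar>y $ j\<bar> = 1"
    using peak_attained[of K j] assms by metis
  have "(norm (y - (y $ j) *\<^sub>R axis j 1))\<^sup>2 = (norm y)\<^sup>2 - (y $ j)\<^sup>2"
    unfolding power2_norm_eq_inner
    by (simp add: inner_diff_left inner_diff_right inner_axis inner_axis' power2_eq_square)
  also have "\<dots> \<le> 0"
    using y by (simp flip: abs_le_square_iff)
  finally have "y = (y $ j) *\<^sub>R axis j 1"
    by simp
  then have "(y $ j) *\<^sub>R y = axis j 1"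
    using y(3) by (metis (no_types) abs_square_eq_1 power2_eq_square scaleR_one scaleR_scaleR)
  then show ?thesis
    using y(1) R by (metis subspace_scale)
qed

lemma peak_pos_iff:
  "0 < peak R K j \<longleftrightarrow> (\<exists>y\<in>R. (\<forall>i\<in>K. y $ i = 0) \<and> y $ j \<noteq> 0)"
proof
  assume "0 < peak R K j"
  then show "\<exists>y\<in>R. (\<forall>i\<in>K. y $ i = 0) \<and> y $ j \<noteq> 0"
    using peak_attained[of K j] by (metis abs_0 less_irrefl)
next
  assume "\<exists>y\<in>R. (\<forall>i\<in>K. y $ i = 0) \<and> y $ j \<noteq> 0"
  then obtain y where "y \<in> R" "\<And>i. i \<in> K \<Longrightarrow> y $ i = 0" "y $ j \<noteq> 0"
    by blast
  then have "0 < peak R K j * norm y"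
    using component_le_peak[of y K j] by auto
  then show "0 < peak R K j"
    by (simp add: zero_less_mult_iff)
qed

end

section \<open>Positivity of the peaks along greedy sequences\<close>

lemma subspace_range_mat: "subspace (range ((*v) A))"
  for A :: "real ^ 'r ^ 'm"
  by (intro linear_subspace_image subspace_UNIV matrix_vector_mul_linear)

lemma exists_orthogonal_family:
  fixes a :: "nat \<Rightarrow> real ^ 'r"
  assumes "k < CARD('r)"
  obtains x where "x \<noteq> 0" "\<And>i. i < k \<Longrightarrow> a i \<bullet> x = 0"
proof -
  have "dim (a ` {..<k}) \<le> k"
    by (metis card_image_le card_lessThan dim_le_card' finite_imageI finite_lessThan order_trans)
  then have "dim (a ` {..<k}) < DIM(real ^ 'r)"
    using assms by simp
  then obtain x where "x \<noteq> 0" "\<And>y. y \<in> span (a ` {..<k}) \<Longrightarrow> orthogonal x y"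
    by (rule orthogonal_to_subspace_exists) blast
  then show thesis
    using that[of x] by (simp add: orthogonal_def inner_commute[of x] span_base)
qed

text \<open>Fewer than r linear conditions leave a nonzero \<open>x\<close>, and injectivity keeps
  \<open>A *v x\<close> nonzero. Hence QDEIM never meets a zero residual during its r steps.\<close>

lemma exists_peak_pos:
  fixes A :: "real ^ 'r ^ 'm"
  assumes inj: "inj ((*v) A)" and k: "k < CARD('r)"
  obtains j where "0 < peak (range ((*v) A)) (p ` {..<k}) j"
proof -
  obtain x where x: "x \<noteq> 0" "\<And>i. i < k \<Longrightarrow> A $ p i \<bullet> x = 0"
    using exists_orthogonal_family[OF k, of "\<lambda>i. A $ p i"] by blast
  have "A *v x \<noteq> 0"
    using inj x(1) by (metis injD matrix_vector_mult_0_right)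
  then obtain j where "(A *v x) $ j \<noteq> 0"
    by (metis vec_eq_iff zero_index)
  then have "0 < peak (range ((*v) A)) (p ` {..<k}) j"
    using x(2) by (subst peak_pos_iff[OF subspace_range_mat]) (auto simp: matrix_vector_mul_component)
  then show thesis
    by (rule that)
qed

text \<open>The maximal peak dominates a positive one. As peaks vanish at indices already chosen,
  this also makes the pivots distinct.\<close>

lemma greedy_peak_pos:
  fixes A :: "real ^ 'r ^ 'm"
  assumes "inj ((*v) A)" "greedy (range ((*v) A)) CARD('r) p" "k < CARD('r)"
  shows "0 < peak (range ((*v) A)) (p ` {..<k}) (p k)"
  using exists_peak_pos[OF assms(1,3), of p] assms(2,3) by (metis greedy_def less_le_trans)

section \<open>Deflation as orthogonal projection of the rows\<close>

lemma row_deflate: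
  fixes A :: "real ^ 'r ^ 'm"
  shows "row j (deflate A i) =
     row j A - (row j A \<bullet> (row i A /\<^sub>R norm (row i A))) *\<^sub>R (row i A /\<^sub>R norm (row i A))"
proof -
  have "row j (A ** (mat 1 - (columnvector u :: real ^ 1 ^ 'r) ** rowvector u)) =
    row j A - (row j A \<bullet> u) *\<^sub>R u" for A :: "real ^ 'r ^ 'm" and u
  proof -
    have "A ** (mat 1 - (columnvector u :: real ^ 1 ^ 'r) ** rowvector u) =
        A - A ** ((columnvector u :: real ^ 1 ^ 'r) ** rowvector u)"
      by (simp add: matrix_eq matrix_vector_mult_diff_rdistrib matrix_vector_mult_diff_distrib
          flip: matrix_vector_mul_assoc)
    then show ?thesis
      by (simp add: vec_eq_iff row_def matrix_matrix_mult_def columnvector_def rowvector_def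
          inner_vec_def sum_distrib_right mult.assoc)
  qed
  then show ?thesis
    by (simp only: deflate_def Let_def)
qed

text \<open>The two halves characterise row \<open>j\<close> of the residual as the orthogonal
  projection of row \<open>j\<close> of \<open>U\<close> onto the complement of the earlier pivot
  rows: inner products with that complement are unchanged, and the row lies in it. Each induction
  step uses both halves.\<close>

lemma qdeim_residual_inner:
  fixes U :: "real ^ 'r ^ 'm"
  shows "(\<forall>j x. (\<forall>i<k. row (p i) U \<bullet> x = 0) \<longrightarrow> row j (qdeim_residual U p k) \<bullet> x = row j U \<bullet> x) \<and>
    (\<forall>j. \<forall>i<k. row (p i) U \<bullet> row j (qdeim_residual U p k) = 0)"
proof (induction k)
  case (Suc k)
  define v where "v j = row j (qdeim_residual U p k)" for j
  \<comment> \<open>A zero pivot row gives \<open>u = 0\<close>, since the inverse of 0 is 0, and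
    deflation then changes nothing.\<close>
  define u where "u = v (p k) /\<^sub>R norm (v (p k))"
  have IH1: "v j \<bullet> x = row j U \<bullet> x" if "\<And>i. i < k \<Longrightarrow> row (p i) U \<bullet> x = 0" for j x
    using Suc that by (simp add: v_def)
  have IH2: "row (p i) U \<bullet> v j = 0" if "i < k" for i j
    using Suc that by (simp add: v_def)
  have v': "row j (qdeim_residual U p (Suc k)) = v j - (v j \<bullet> u) *\<^sub>R u" for j
    by (simp add: row_deflate u_def v_def)
  \<comment> \<open>\<open>v j\<close> is orthogonal to the earlier pivot rows, so
    \<open>IH1\<close> applies to it and lets the residual row stand for row \<open>p k\<close> of
    \<open>U\<close>.\<close>
  have pv: "row (p k) U \<bullet> v j = v (p k) \<bullet> v j" for j
    using IH1[of "v j" "p k"] IH2 by simp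
  have "row j (qdeim_residual U p (Suc k)) \<bullet> x = row j U \<bullet> x"
    if x: "\<And>i. i < Suc k \<Longrightarrow> row (p i) U \<bullet> x = 0" for j x
  proof -
    have "u \<bullet> x = 0"
      using IH1[of x "p k"] x by (simp add: u_def)
    then show ?thesis
      using IH1[of x j] x by (simp only: v' inner_diff_left inner_scaleR_left)
  qed
  moreover have "row (p i) U \<bullet> row j (qdeim_residual U p (Suc k)) = 0" if "i < Suc k" for i j
  proof (cases "i = k")
    case True
    have "row (p k) U \<bullet> u = norm (v (p k))"
      by (cases "v (p k) = 0") (simp_all add: u_def pv dot_square_norm power2_eq_square)
    then show ?thesis
      unfolding True v' inner_diff_right pv inner_scaleR_right
      by (cases "v (p k) = 0") (simp_all add: u_def inner_commute)
  next
    case False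
    then show ?thesis
      using that IH2 unfolding v' by (simp add: u_def inner_diff_right)
  qed
  ultimately show ?case
    by blast
qed simp

lemma orthonormal_inner:
  fixes U :: "real ^ 'r ^ 'm"
  assumes "orthonormal_columns U"
  shows "(U *v x) \<bullet> (U *v y) = x \<bullet> y"
proof -
  have "(U *v x) \<bullet> (U *v y) = x \<bullet> (transpose U *v (U *v y))"
    using dot_lmul_matrix[of x "transpose U" "U *v y"] by simp
  also have "transpose U *v (U *v y) = y"
    using assms by (simp only: orthonormal_columns_def matrix_vector_mul_assoc matrix_vector_mul_lid)
  finally show ?thesis .
qed

lemma orthonormal_norm: "orthonormal_columns U \<Longrightarrow> norm (U *v x) = norm x"
  for U :: "real ^ 'r ^ 'm"
  by (simp add: norm_eq_sqrt_inner orthonormal_inner)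

lemma orthonormal_inj: "orthonormal_columns U \<Longrightarrow> inj ((*v) U)"
  unfolding orthonormal_columns_def using matrix_left_invertible_injective by blast

text \<open>\<open>U *v x\<close> vanishes at the pivots iff \<open>x\<close> is orthogonal to the
  pivot rows. Its component \<open>j\<close> is then the inner product of \<open>x\<close> with the
  residual row, and its norm is that of \<open>x\<close>. Cauchy-Schwarz bounds the peak; taking the
  residual row for \<open>x\<close> gives equality.\<close>

lemma norm_qdeim_residual:
  fixes U :: "real ^ 'r ^ 'm"
  assumes U: "orthonormal_columns U"
  shows "norm (row j (qdeim_residual U p k)) = peak (range ((*v) U)) (p ` {..<k}) j"
proof -
  let ?v = "row j (qdeim_residual U p k)" and ?R = "range ((*v) U)"
  have v: "?v \<bullet> x = row j U \<bullet> x" if "\<And>i. i < k \<Longrightarrow> row (p i) U \<bullet> x = 0" for x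
    using that qdeim_residual_inner[where k = k and U = U and p = p] by blast
  have o: "row (p i) U \<bullet> ?v = 0" if "i < k" for i
    using that qdeim_residual_inner[where k = k and U = U and p = p] by blast
  have comp: "(U *v x) $ i = row i U \<bullet> x" for x i
    by (simp add: matrix_vector_mul_component row_def)
  show ?thesis
  proof (rule antisym)
    have "\<bar>(U *v ?v) $ j\<bar> \<le> peak ?R (p ` {..<k}) j * norm (U *v ?v)"
      using o by (intro component_le_peak[OF subspace_range_mat]) (auto simp: comp)
    then have "(norm ?v)\<^sup>2 \<le> peak ?R (p ` {..<k}) j * norm ?v"
      using v[of ?v] o by (simp add: comp orthonormal_norm[OF U] flip: power2_norm_eq_inner)
    then show "norm ?v \<le> peak ?R (p ` {..<k}) j"
      using peak_nonneg[OF subspace_range_mat, of U "p ` {..<k}" j]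
      by (cases "?v = 0") (auto simp: power2_eq_square)
    show "peak ?R (p ` {..<k}) j \<le> norm ?v"
    proof (rule peak_leI[OF subspace_range_mat])
      fix y assume "y \<in> ?R" and y: "\<And>i. i \<in> p ` {..<k} \<Longrightarrow> y $ i = 0"
      then obtain x where x: "y = U *v x"
        by blast
      then have "y $ j = ?v \<bullet> x"
        using y v[of x] by (auto simp: comp)
      then show "\<bar>y $ j\<bar> \<le> norm ?v * norm y"
        by (simp add: x orthonormal_norm[OF U] Cauchy_Schwarz_ineq2)
    qed simp
  qed
qed

section \<open>Feasible pivot sequences and the one chosen by tie-breaking\<close>

lemma max_rows_iff: "i \<in> max_rows A \<longleftrightarrow> (\<forall>j. norm (row j A) \<le> norm (row i A))"
  unfolding max_rows_def
  by (auto simp: Max_ge intro!: Max_eqI[symmetric])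

lemma qdeim_feasible_iff_greedy:
  fixes U :: "real ^ 'r ^ 'm"
  assumes "orthonormal_columns U"
  shows "qdeim_feasible U p \<longleftrightarrow> greedy (range ((*v) U)) CARD('r) p"
  by (simp add: qdeim_feasible_def greedy_def max_rows_iff norm_qdeim_residual[OF assms])

definition qdeim_pivot :: "real ^ 'r ^ 'm::{finite,linorder} \<Rightarrow> nat \<Rightarrow> 'm" where
  "qdeim_pivot U k = Min (max_rows (qdeim_iterate U k))"

lemma qdeim_eq: "qdeim U = selection_matrix (qdeim_pivot U)"
  by (simp add: qdeim_def qdeim_pivot_def[abs_def])

lemma qdeim_iterate_eq: "qdeim_iterate U k = qdeim_residual U (qdeim_pivot U) k"
  by (induction k) (simp_all add: qdeim_pivot_def)

lemma max_rows_nonempty: "max_rows A \<noteq> {}"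
proof -
  have "Max (range (\<lambda>j. norm (row j A))) \<in> range (\<lambda>j. norm (row j A))"
    by (intro Max_in) auto
  then show ?thesis
    unfolding max_rows_def by force
qed

lemma qdeim_pivot_feasible: "qdeim_feasible U (qdeim_pivot U)"
proof -
  have "qdeim_pivot U k \<in> max_rows (qdeim_iterate U k)" for k
    unfolding qdeim_pivot_def by (intro Min_in max_rows_nonempty) simp
  then show ?thesis
    by (simp add: qdeim_feasible_def qdeim_iterate_eq)
qed

text \<open>Column positions are below r, so later values of a pivot sequence never enter the
  matrix.\<close>

lemma selection_matrix_cong:
  assumes "\<And>k. k < CARD('r) \<Longrightarrow> p k = q k"
  shows "(selection_matrix p :: real ^ 'r::{finite,linorder} ^ 'm) = selection_matrix q"
proof -
  have "card {..<j} < CARD('r)" for j :: 'r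
    by (intro psubset_card_mono) auto
  then show ?thesis
    by (simp add: selection_matrix_def assms)
qed

text \<open>By strong induction: once the earlier pivots agree, both sequences compare the same
  peaks, and a strict maximiser leaves no choice.\<close>

lemma strictly_greedy_unique:
  assumes "strictly_greedy R r p" "greedy R r q" "k < r"
  shows "q k = p k"
  using \<open>k < r\<close>
proof (induction k rule: less_induct)
  case (less k)
  then have "q ` {..<k} = p ` {..<k}"
    by (intro image_cong) auto
  then show ?case
    using assms less.prems unfolding greedy_def strictly_greedy_def
    by (metis not_less)
qed

text \<open>QDEIM with tie-breaking is a feasible run, and here its first r pivots are
  forced.\<close>

lemma qdeim_eq_if_strictly_greedy:
  fixes U :: "real ^ 'r::{finite,linorder} ^ 'm::{finite,linorder}"
  assumes "orthonormal_columns U" "strictly_greedy (range ((*v) U)) CARD('r) p"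
  shows "qdeim U = selection_matrix p"
  unfolding qdeim_eq
  by (intro selection_matrix_cong strictly_greedy_unique[OF assms(2)])
    (simp flip: qdeim_feasible_iff_greedy[OF assms(1)] add: qdeim_pivot_feasible)

subsection \<open>Breaking ties by scaling\<close>

definition diag :: "('m \<Rightarrow> real) \<Rightarrow> real ^ 'm ^ 'm" where
  "diag d = (\<chi> i j. if i = j then d i else 0)"

lemma diag_mult_vec [simp]: "(diag d *v x) $ i = d i * x $ i"
  by (simp add: diag_def matrix_vector_mult_def if_distrib[where f = "\<lambda>a. a * _"] cong: if_cong)

lemma norm_power2_sum: "(norm x)\<^sup>2 = (\<Sum>i\<in>UNIV. (x $ i)\<^sup>2)" for x :: "real ^ 'm"
  by (simp add: power2_norm_eq_inner inner_vec_def flip: power2_eq_square)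

lemma norm_power2_split: "(norm x)\<^sup>2 = (x $ q)\<^sup>2 + (\<Sum>i\<in>-{q}. (x $ i)\<^sup>2)" for x :: "real ^ 'm"
  unfolding norm_power2_sum by (subst sum.remove[of _ q]) (auto simp: Compl_eq_Diff_UNIV)

lemma subspace_image_mat: "subspace R \<Longrightarrow> subspace ((*v) A ` R)"
  for A :: "real ^ 'n ^ 'm"
  by (intro linear_subspace_image matrix_vector_mul_linear)

text \<open>The square of component \<open>q\<close> gains the factor \<open>(d q)\<^sup>2\<close>,
  while every other square outside \<open>K\<close> gains at most \<beta> and never shrinks. A
  competitor can profit from \<beta> once in its own component, and \<open>q\<close> can lose it
  once through the other components, so the gain at \<open>q\<close> has to beat the square of
  \<beta>. A peak equal to 1 stays 1 under scaling, hence the strict bound.\<close>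

lemma peak_diag_less:
  fixes R :: "(real ^ 'm) set"
  assumes R: "subspace R"
    and c: "0 < peak R K q" "peak R K q < 1" "\<And>j. peak R K j \<le> peak R K q"
    and d1: "\<And>i. 1 \<le> d i" and \<beta>1: "1 \<le> \<beta>" and db: "\<And>i. i \<notin> K \<Longrightarrow> i \<noteq> q \<Longrightarrow> (d i)\<^sup>2 \<le> \<beta>"
    and dq: "\<beta>\<^sup>2 < (d q)\<^sup>2" and j: "j \<noteq> q"
  shows "peak ((*v) (diag d) ` R) K j < peak ((*v) (diag d) ` R) K q"
proof -
  let ?R = "(*v) (diag d) ` R"
  have R': "subspace ?R"
    using R by (rule subspace_image_mat)
  txt \<open>With \<open>c2\<close> the common bound on the squared peaks before scaling, \<open>M\<close> bounds the squared peak
    at \<open>j\<close> from above and \<open>L\<close> the one at \<open>q\<close> from below.\<close>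
  define c2 where "c2 = (peak R K q)\<^sup>2"
  define \<alpha> where "\<alpha> = (d q)\<^sup>2"
  define L where "L = \<alpha> * c2 / (\<alpha> * c2 + \<beta> * (1 - c2))"
  define M where "M = \<beta> * c2 / (\<beta> * c2 + (1 - c2))"
  have c2: "0 < c2" "c2 < 1"
    using c by (simp_all add: c2_def power_less_one_iff)
  have \<alpha>: "1 \<le> \<alpha>"
    using d1[of q] by (simp add: \<alpha>_def one_le_power)
  have pos: "0 < \<alpha> * c2 + \<beta> * (1 - c2)" "0 < \<beta> * c2 + (1 - c2)"
    using c2 \<alpha> \<beta>1 by (auto intro!: add_pos_pos)
  have "\<beta>\<^sup>2 * (1 - c2) < \<alpha> * (1 - c2)"
    using dq c2 by (simp add: \<alpha>_def)
  then have "\<beta> * c2 * (\<alpha> * c2 + \<beta> * (1 - c2)) < \<alpha> * c2 * (\<beta> * c2 + (1 - c2))"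
    using mult_strict_left_mono[of "\<beta>\<^sup>2 * (1 - c2)" "\<alpha> * (1 - c2)" c2] c2
    by (simp add: algebra_simps power2_eq_square)
  \<comment> \<open>The preceding inequality is this one cross-multiplied; its common terms cancel
    down to \<open>\<beta>\<^sup>2 < \<alpha>\<close>, up to positive factors.\<close>
  then have "M < L"
    using pos by (simp add: M_def L_def divide_simps)
  have "0 \<le> M"
    using pos c2 \<beta>1 by (simp add: M_def)
  have "L \<le> (peak ?R K q)\<^sup>2"
  proof -
    \<comment> \<open>The image of a vector attaining the old peak at \<open>q\<close> serves as
      test vector for the new one.\<close>
    obtain z where z: "z \<in> R" "norm z \<le> 1" "\<And>i. i \<in> K \<Longrightarrow> z $ i = 0" "\<bar>z $ q\<bar> = peak R K q"
      using peak_attained[OF R, of K q] by blast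
    let ?y = "diag d *v z"
    have zq: "(z $ q)\<^sup>2 = c2"
      using z(4) by (metis c2_def power2_abs)
    have "(norm ?y)\<^sup>2 = \<alpha> * c2 + (\<Sum>i\<in>-{q}. (d i)\<^sup>2 * (z $ i)\<^sup>2)"
      by (simp add: norm_power2_split[of _ q] power_mult_distrib zq \<alpha>_def)
    also have "(\<Sum>i\<in>-{q}. (d i)\<^sup>2 * (z $ i)\<^sup>2) \<le> (\<Sum>i\<in>-{q}. \<beta> * (z $ i)\<^sup>2)"
    proof (rule sum_mono)
      fix i assume "i \<in> -{q}"
      then show "(d i)\<^sup>2 * (z $ i)\<^sup>2 \<le> \<beta> * (z $ i)\<^sup>2"
        using db[of i] z(3)[of i] by (cases "i \<in> K") (auto intro!: mult_right_mono)
    qed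
    also have "\<dots> = \<beta> * ((norm z)\<^sup>2 - c2)"
      by (simp add: norm_power2_split[of z q] zq sum_distrib_left)
    also have "\<dots> \<le> \<beta> * (1 - c2)"
      using \<beta>1 z(2) by (intro mult_left_mono) (auto simp: power_le_one_iff)
    finally have N: "(norm ?y)\<^sup>2 \<le> \<alpha> * c2 + \<beta> * (1 - c2)"
      by simp
    have "\<bar>?y $ q\<bar> \<le> peak ?R K q * norm ?y"
      using z by (intro component_le_peak[OF R']) auto
    then have "\<bar>?y $ q\<bar>\<^sup>2 \<le> (peak ?R K q * norm ?y)\<^sup>2"
      by (intro power_mono) auto
    then have "\<alpha> * c2 \<le> (peak ?R K q)\<^sup>2 * (norm ?y)\<^sup>2"
      by (simp add: power_mult_distrib zq \<alpha>_def)
    also have "\<dots> \<le> (peak ?R K q)\<^sup>2 * (\<alpha> * c2 + \<beta> * (1 - c2))"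
      using N by (intro mult_left_mono) auto
    finally show ?thesis
      using pos by (simp add: L_def divide_simps)
  qed
  moreover have "peak ?R K j \<le> sqrt M"
  proof (rule peak_leI[OF R'])
    fix y assume "y \<in> ?R" and yK: "\<And>i. i \<in> K \<Longrightarrow> y $ i = 0"
    then obtain z where z: "z \<in> R" "y = diag d *v z"
      by blast
    have zK: "z $ i = 0" if "i \<in> K" for i
      using yK[OF that] d1[of i] by (simp add: z(2))
    show "\<bar>y $ j\<bar> \<le> sqrt M * norm y"
    proof (cases "j \<in> K")
      case False
      let ?a = "(d j)\<^sup>2" and ?b = "(z $ j)\<^sup>2" and ?n = "(norm z)\<^sup>2"
      have "\<bar>z $ j\<bar> \<le> peak R K q * norm z"
        using component_le_peak[OF R z(1), of K j] zK mult_right_mono[OF c(3)[of j], of "norm z"]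
        by simp
      then have "\<bar>z $ j\<bar>\<^sup>2 \<le> (peak R K q * norm z)\<^sup>2"
        by (intro power_mono) auto
      then have b: "?b \<le> c2 * ?n"
        by (simp add: power_mult_distrib c2_def)
      have "?n - ?b = (\<Sum>i\<in>-{j}. 1 * (z $ i)\<^sup>2)"
        by (simp add: norm_power2_split[of z j])
      also have "\<dots> \<le> (\<Sum>i\<in>-{j}. (d i)\<^sup>2 * (z $ i)\<^sup>2)"
        using d1 by (intro sum_mono mult_right_mono) (auto simp: one_le_power)
      finally have n: "?a * ?b + (?n - ?b) \<le> (norm y)\<^sup>2"
        by (simp add: z(2) norm_power2_split[of _ j] power_mult_distrib)
      \<comment> \<open>The old bound on \<open>?b\<close>, rearranged to compare \<open>?b\<close>
        with the remaining mass \<open>?n - ?b\<close>, is multiplied by the bound \<beta> on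
        \<open>?a\<close>.\<close>
      have "?a * (?b * (1 - c2)) \<le> \<beta> * (c2 * (?n - ?b))"
      proof (rule mult_mono[OF db[OF False j]])
        show "?b * (1 - c2) \<le> c2 * (?n - ?b)"
          using b by (simp add: algebra_simps)
      qed (use c2 \<beta>1 in auto)
      then have "?a * ?b * (\<beta> * c2 + (1 - c2)) \<le> \<beta> * c2 * (?a * ?b + (?n - ?b))"
        by (simp add: algebra_simps)
      also have "\<dots> \<le> \<beta> * c2 * (norm y)\<^sup>2"
        using n c2 \<beta>1 by (intro mult_left_mono) auto
      finally have "(y $ j)\<^sup>2 \<le> M * (norm y)\<^sup>2"
        using pos by (simp add: z(2) M_def divide_simps power_mult_distrib)
      then show ?thesis
        using real_sqrt_le_mono by (fastforce simp: real_sqrt_mult)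
    qed (simp add: yK \<open>0 \<le> M\<close>)
  qed (use \<open>0 \<le> M\<close> in simp)
  moreover have "sqrt M < sqrt L"
    using \<open>M < L\<close> by simp
  ultimately show ?thesis
    using real_le_lsqrt[of "peak ?R K q" L] peak_nonneg[OF R', of K q] by linarith
qed

text \<open>\<open>peak_diag_less\<close> is applied at every step with the same exponents. They do
  not depend on \<delta>, so the scaling can approach the identity while the order stays strict.
  Earlier pivots carry larger factors, but these act only on coordinates that are zero by
  then.\<close>

lemma diag_strictly_greedy:
  fixes R :: "(real ^ 'm) set"
  assumes R: "subspace R" and p: "greedy R r p"
    and pos: "\<And>k. k < r \<Longrightarrow> 0 < peak R (p ` {..<k}) (p k)"
    and axis: "\<And>j. axis j 1 \<notin> R"
  obtains e where "\<And>\<delta>. 1 < \<delta> \<Longrightarrow> strictly_greedy ((*v) (diag (\<lambda>i. \<delta> ^ e i)) ` R) r p"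
proof
  txt \<open>Base 3 because \<open>peak_diag_less\<close> needs the scaling factor at a pivot to exceed the square of
    all factors still in play.\<close>
  define e where "e i = (if i \<in> p ` {..<r} then 3 ^ (r - the_inv_into {..<r} p i) else 0 :: nat)" for i
  fix \<delta> :: real assume \<delta>: "1 < \<delta>"
  have new: "p k \<notin> p ` {..<k}" if "k < r" for k
    using pos[OF that] peak_eq_0[OF R, of "p k" "p ` {..<k}"] by auto
  have inj: "inj_on p {..<r}"
    using new by (intro linorder_inj_onI') (metis imageI lessThan_iff)
  have ep: "e (p k) = 3 ^ (r - k)" if "k < r" for k
    using that by (simp add: e_def the_inv_into_f_f[OF inj])
  show "strictly_greedy ((*v) (diag (\<lambda>i. \<delta> ^ e i)) ` R) r p"
    unfolding strictly_greedy_def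
  proof (intro allI impI)
    fix k j assume k: "k < r" and j: "j \<noteq> p k"
    \<comment> \<open>The largest square of a factor still competing with \<open>p k\<close>.
      Squared, it has exponent \<open>4 * 3 ^ (r - Suc k)\<close>, against
      \<open>6 * 3 ^ (r - Suc k)\<close> for the squared factor at \<open>p k\<close>.\<close>
    let ?\<beta> = "\<delta> ^ (2 * 3 ^ (r - Suc k))"
    have rk: "r - k = Suc (r - Suc k)"
      using k by simp
    show "peak ((*v) (diag (\<lambda>i. \<delta> ^ e i)) ` R) (p ` {..<k}) j
        < peak ((*v) (diag (\<lambda>i. \<delta> ^ e i)) ` R) (p ` {..<k}) (p k)"
    proof (rule peak_diag_less[OF R, where \<beta> = ?\<beta>])
      show "peak R (p ` {..<k}) (p k) < 1"
        using peak_le_1[OF R] peak_eq_1_imp_axis[OF R] axis by (metis less_eq_real_def)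
      show "(\<delta> ^ e i)\<^sup>2 \<le> ?\<beta>" if i: "i \<notin> p ` {..<k}" "i \<noteq> p k" for i
      proof -
        have "e i \<le> 3 ^ (r - Suc k)"
        proof (cases "i \<in> p ` {..<r}")
          case True
          then obtain l where l: "l < r" "i = p l"
            by auto
          with i have "k < l"
            by (metis image_eqI lessThan_iff linorder_less_linear)
          with l show ?thesis
            by (auto simp: ep intro!: power_increasing)
        qed (simp add: e_def)
        then show ?thesis
          using \<delta> by (simp flip: power_mult)
      qed
      show "?\<beta>\<^sup>2 < (\<delta> ^ e (p k))\<^sup>2"
        using \<delta> k by (simp add: ep rk flip: power_mult)
    qed (use \<delta> j k pos p in \<open>auto simp: greedy_def one_le_power\<close>)
  qed
qed

subsection \<open>Removing unit vectors by tilting\<close>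

text \<open>With \<open>T\<close> the set of unit vectors in \<open>R\<close>, each of them moves by
  the same vector \<open>t *\<^sub>R w\<close>, which keeps their mutual ties, while vectors
  vanishing on \<open>T\<close> stay fixed.\<close>

definition tilt :: "'m set \<Rightarrow> real ^ 'm \<Rightarrow> real \<Rightarrow> real ^ 'm ^ 'm" where
  "tilt T w t = mat 1 + t *\<^sub>R (\<chi> i j. if j \<in> T then w $ i else 0)"

lemma tilt_mult_vec: "tilt T w t *v z = z + (t * (\<Sum>j\<in>T. z $ j)) *\<^sub>R w"
proof -
  have "(\<chi> i j. if j \<in> T then w $ i else 0) *v z = (\<Sum>j\<in>T. z $ j) *\<^sub>R w"
    by (simp add: vec_eq_iff matrix_vector_mult_def sum_distrib_left mult.commute[of "w $ _"] sum_distrib_right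
        if_distrib[where f = "\<lambda>a. a * _"] if_distrib[where f = "\<lambda>a. _ * a"] sum.If_cases cong: if_cong)
  then show ?thesis
    by (simp add: tilt_def matrix_vector_mult_add_rdistrib scaleR_matrix_vector_assoc[symmetric])
qed

lemma tilt_greedy:
  fixes R :: "(real ^ 'm) set"
  assumes R: "subspace R" and p: "greedy R r p"
    and pos: "\<And>k. k < r \<Longrightarrow> 0 < peak R (p ` {..<k}) (p k)"
    and wR: "\<And>z. z \<in> R \<Longrightarrow> z \<bullet> w = 0" and w1: "norm w = 1"
  shows "\<forall>\<^sub>F t in at_right 0. greedy ((*v) (tilt {j. axis j 1 \<in> R} w t) ` R) r p \<and>
    (\<forall>j. axis j 1 \<notin> (*v) (tilt {j. axis j 1 \<in> R} w t) ` R)"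
proof -
  define T where "T = {j. axis j 1 \<in> R}"
  \<comment> \<open>A uniform bound below 1 for the peaks outside \<open>T\<close>; the inserted 0
    covers an empty complement.\<close>
  define \<rho> where "\<rho> = Max (insert 0 ((\<lambda>j. peak R {} j) ` (-T)))"
  have "peak R {} j < 1" if "j \<notin> T" for j
    using peak_le_1[OF R, of "{}" j] peak_eq_1_imp_axis[OF R, of "{}" j] that
    unfolding T_def less_le by blast
  then have "\<rho> < 1"
    by (simp add: \<rho>_def)
  have \<rho>: "peak R {} j \<le> \<rho>" if "j \<notin> T" for j
    unfolding \<rho>_def using that by (intro Max_ge) auto
  have wT: "w $ j = 0" if "j \<in> T" for j
    using wR[of "axis j 1"] that by (simp add: T_def inner_axis')
  \<comment> \<open>The first term bounds the peak of a tilted unit vector from below. The second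
    bounds the peaks outside \<open>T\<close> from above, the sum over \<open>T\<close> being at
    most \<open>CARD('m)\<close> times the norm. At \<open>t = 0\<close> they are 1 and
    \<rho>.\<close>
  have "\<forall>\<^sub>F t in at_right 0. 0 < 1 / sqrt (1 + t\<^sup>2) - (\<rho> + t * real CARD('m))"
    using \<open>\<rho> < 1\<close> by (intro order_tendstoD(1)[where y = "1 - \<rho>"]) (auto intro!: tendsto_eq_intros)
  moreover have "\<forall>\<^sub>F t :: real in at_right 0. 0 < t"
    by (simp add: eventually_at_right_less)
  ultimately show ?thesis
  proof eventually_elim
    case (elim t)
    then have t: "0 < t" and small: "\<rho> + t * real CARD('m) \<le> 1 / sqrt (1 + t\<^sup>2)"
      by auto
    let ?A = "tilt T w t"
    let ?R = "(*v) ?A ` R"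
    define \<sigma> where "\<sigma> z = (\<Sum>j\<in>T. z $ j)" for z :: "real ^ 'm"
    have R': "subspace ?R"
      using R by (rule subspace_image_mat)
    have A: "?A *v z = z + (t * \<sigma> z) *\<^sub>R w" for z
      by (simp add: tilt_mult_vec \<sigma>_def)
    have AT: "(?A *v z) $ i = z $ i" if "i \<in> T" for z i
      using wT[OF that] by (simp add: A)
    have nA: "(norm (?A *v z))\<^sup>2 = (norm z)\<^sup>2 + (t * \<sigma> z)\<^sup>2" if "z \<in> R" for z
    proof -
      have "orthogonal z ((t * \<sigma> z) *\<^sub>R w)"
        using wR[OF that] by (simp add: orthogonal_def)
      then show ?thesis
        unfolding A by (simp add: norm_add_Pythagorean w1)
    qed
    have nA_ge: "norm z \<le> norm (?A *v z)" if "z \<in> R" for z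
      by (rule power2_le_imp_le) (simp_all add: nA[OF that])
    have \<sigma>0: "\<sigma> z = 0" if "\<And>i. i \<in> T \<Longrightarrow> z $ i = 0" for z
      using that by (simp add: \<sigma>_def)
    \<comment> \<open>Once \<open>T\<close> is exhausted, the vectors over which a peak is taken are
      the same before and after tilting.\<close>
    have same: "{y \<in> ?R. norm y \<le> 1 \<and> (\<forall>i\<in>K. y $ i = 0)} = {y \<in> R. norm y \<le> 1 \<and> (\<forall>i\<in>K. y $ i = 0)}"
      if K: "T \<subseteq> K" for K
    proof -
      have fix_z: "?A *v z = z" if "\<And>i. i \<in> T \<Longrightarrow> z $ i = 0" for z
        using \<sigma>0[OF that] by (simp add: A)
      have "y \<in> ?R \<longleftrightarrow> y \<in> R" if "\<forall>i\<in>K. y $ i = 0" for y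
      proof
        assume "y \<in> ?R"
        then obtain z where "z \<in> R" "y = ?A *v z"
          by blast
        with fix_z[of z] AT[of _ z] K that show "y \<in> R"
          by (metis subsetD)
      next
        assume "y \<in> R"
        with fix_z[of y] K that show "y \<in> ?R"
          by (metis image_eqI subsetD)
      qed
      then show ?thesis
        by blast
    qed
    \<comment> \<open>For \<open>j\<close> in \<open>T\<close> the vector
      \<open>t *\<^sub>R w\<close> would lie in \<open>R\<close>, to which \<open>w\<close> is
      orthogonal. For other \<open>j\<close> the preimage would be the unit vector itself, so
      \<open>j\<close> would be in \<open>T\<close>.\<close>
    have "axis j 1 \<notin> ?R" for j
    proof
      assume "axis j 1 \<in> ?R"
      then obtain z where z: "z \<in> R" "axis j 1 = ?A *v z"
        by blast
      have zT: "z $ i = (if i = j then 1 else 0)" if "i \<in> T" for i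
        using AT[OF that, of z] by (simp add: axis_def flip: z(2))
      show False
      proof (cases "j \<in> T")
        case True
        then have "\<sigma> z = 1"
          by (simp add: \<sigma>_def zT)
        then have "axis j 1 - z = t *\<^sub>R w"
          using z(2) by (simp add: A)
        moreover have "axis j 1 - z \<in> R"
          using True z(1) R by (simp add: T_def subspace_diff)
        ultimately show False
          using wR[of "t *\<^sub>R w"] t w1 by (auto simp: dot_square_norm)
      next
        case False
        then have "\<sigma> z = 0"
          using zT by (intro \<sigma>0) auto
        then have "z = axis j 1"
          using z(2) by (simp add: A)
        then show False
          using False z(1) by (simp add: T_def)
      qed
    qed
    moreover have "peak ?R (p ` {..<k}) j \<le> peak ?R (p ` {..<k}) (p k)" if k: "k < r" for k j
    proof (cases "T \<subseteq> p ` {..<k}")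
      case True
      then show ?thesis
        using p k same[OF True] by (simp add: greedy_def peak_def)
    next
      case False
      have pT: "p l \<in> T" if "l \<le> k" for l
      proof -
        obtain i where "i \<in> T" "i \<notin> p ` {..<l}"
          using False \<open>l \<le> k\<close> by (fastforce simp: subset_iff)
        then have "1 \<le> peak R (p ` {..<l}) (p l)"
          using p k \<open>l \<le> k\<close> peak_axis[OF R, of i "p ` {..<l}"]
          by (metis T_def greedy_def mem_Collect_eq order.strict_trans1)
        then show ?thesis
          using peak_le_1[OF R] peak_eq_1_imp_axis[OF R] by (metis T_def mem_Collect_eq antisym)
      qed
      define K where "K = p ` {..<k}"
      have KT: "K \<subseteq> T"
        using pT by (auto simp: K_def)
      have q: "p k \<in> T" "p k \<notin> K"
        using pT peak_eq_0[OF R, of "p k" K] pos[OF k] by (auto simp: K_def)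
      show ?thesis
        unfolding K_def[symmetric]
      proof (rule peak_leI[OF R' peak_nonneg[OF R']])
        fix y assume "y \<in> ?R" and yK: "\<And>i. i \<in> K \<Longrightarrow> y $ i = 0"
        then obtain z where z: "z \<in> R" "y = ?A *v z"
          by blast
        consider "j \<in> K" | "j \<in> T" "j \<notin> K" "j \<noteq> p k" | "j = p k" | "j \<notin> T"
          by blast
        then show "\<bar>y $ j\<bar> \<le> peak ?R K (p k) * norm y"
        proof cases
          case 1
          then show ?thesis
            using yK peak_nonneg[OF R'] by simp
        next
          case 2
          txt \<open>Swapping the coordinates \<open>j\<close> and \<open>p k\<close> preserves \<open>R\<close>, \<open>\<sigma>\<close> and \<open>w\<close>, so both peaks agree.\<close>
          let ?d = "axis j 1 - axis (p k) 1 :: real ^ 'm"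
          let ?a = "z $ p k - z $ j"
          let ?z = "z + ?a *\<^sub>R ?d"
          have zR: "?z \<in> R"
            using R z(1) 2 q by (intro subspace_add subspace_scale subspace_diff) (auto simp: T_def)
          have "\<sigma> ?d = 0"
            using 2 q by (simp add: \<sigma>_def sum_subtractf axis_def)
          moreover have "\<sigma> ?z = \<sigma> z + ?a * \<sigma> ?d"
            by (simp only: \<sigma>_def vector_add_component vector_scaleR_component sum.distrib
                sum_distrib_left real_scaleR_def)
          ultimately have \<sigma>: "\<sigma> ?z = \<sigma> z"
            by simp
          have "?d \<bullet> ?d = 2" "z \<bullet> ?d = - ?a"
            using 2 by (simp_all add: inner_diff inner_axis) (simp add: axis_def)
          then have "?z \<bullet> ?z = z \<bullet> z"
            by (simp only: inner_add inner_scaleR_left inner_scaleR_right inner_commute[of ?d z])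
              (simp add: algebra_simps)
          then have "norm ?z = norm z"
            by (simp only: norm_eq_sqrt_inner)
          then have "(norm (?A *v ?z))\<^sup>2 = (norm (?A *v z))\<^sup>2"
            by (simp only: nA[OF zR] nA[OF z(1)] \<sigma>)
          then have "norm (?A *v ?z) = norm (?A *v z)"
            by (rule power2_eq_imp_eq) simp_all
          moreover have "(?A *v ?z) $ i = 0" if "i \<in> K" for i
            using AT[of i z] AT[of i ?z] that KT yK[OF that] 2 q by (auto simp: axis_def z(2))
          moreover have "(?A *v ?z) $ p k = y $ j"
            using AT[of "p k" ?z] AT[of j z] 2 q by (simp add: axis_def z(2))
          ultimately show ?thesis
            using component_le_peak[OF R', of "?A *v ?z" K "p k"] zR z(2) by auto
        next
          case 3
          then show ?thesis
            using component_le_peak[OF R' \<open>y \<in> ?R\<close> yK] by simp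
        next
          case 4
          have "\<bar>\<sigma> z\<bar> \<le> (\<Sum>j\<in>T. norm z)"
            unfolding \<sigma>_def by (intro order_trans[OF sum_abs] sum_mono component_le_norm_cart)
          also have "\<dots> \<le> real CARD('m) * norm z"
            by (auto intro!: mult_right_mono card_mono)
          finally have \<sigma>: "\<bar>\<sigma> z\<bar> \<le> real CARD('m) * norm z" .
          have "\<bar>w $ j\<bar> \<le> 1"
            using component_le_norm_cart[of w j] w1 by simp
          then have "\<bar>\<sigma> z\<bar> * \<bar>w $ j\<bar> \<le> real CARD('m) * norm z"
            using mult_mono[OF \<sigma>, of "\<bar>w $ j\<bar>" 1] by simp
          then have "t * (\<bar>\<sigma> z\<bar> * \<bar>w $ j\<bar>) \<le> t * (real CARD('m) * norm z)"
            using t by (intro mult_left_mono) auto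
          then have "\<bar>t * \<sigma> z * w $ j\<bar> \<le> t * real CARD('m) * norm z"
            using t by (simp add: abs_mult mult.assoc)
          moreover have "\<bar>z $ j\<bar> \<le> \<rho> * norm z"
            using component_le_peak[OF R z(1), of "{}" j] mult_right_mono[OF \<rho>[OF 4], of "norm z"] by simp
          moreover have "\<bar>y $ j\<bar> \<le> \<bar>z $ j\<bar> + \<bar>t * \<sigma> z * w $ j\<bar>"
            by (simp add: z(2) A abs_triangle_ineq)
          ultimately have "\<bar>y $ j\<bar> \<le> (\<rho> + t * real CARD('m)) * norm z"
            by (simp add: distrib_right)
          also have "\<dots> \<le> 1 / sqrt (1 + t\<^sup>2) * norm y"
            using small nA_ge[OF z(1)] z(2) by (intro mult_mono) auto
          also have "1 / sqrt (1 + t\<^sup>2) \<le> peak ?R K (p k)"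
          proof -
            \<comment> \<open>Tilted, this vector still vanishes on \<open>K\<close> and has
              component 1 at \<open>p k\<close>, and its norm is
              \<open>sqrt (1 + t\<^sup>2)\<close>; it witnesses the lower bound.\<close>
            let ?e = "axis (p k) 1 :: real ^ 'm"
            have e: "?e \<in> R"
              using q by (simp add: T_def)
            have "\<sigma> ?e = 1"
              using q by (simp add: \<sigma>_def axis_def)
            then have "norm (?A *v ?e) = sqrt (1 + t\<^sup>2)"
              using nA[OF e] by (intro real_sqrt_unique[symmetric]) auto
            moreover have "(?A *v ?e) $ i = 0" if "i \<in> K" for i
              using AT[of i ?e] that KT q by (auto simp: axis_def)
            moreover have "(?A *v ?e) $ p k = 1"
              using AT[OF q(1), of ?e] by simp
            moreover have "0 < sqrt (1 + t\<^sup>2)"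
              by (simp add: add_pos_nonneg)
            ultimately show ?thesis
              using component_le_peak[OF R', of "?A *v ?e" K "p k"] e
              by (auto simp: divide_simps)
          qed
          finally show ?thesis
            by (simp add: mult_right_mono)
        qed
      qed
    qed
    ultimately show ?case
      by (simp add: greedy_def T_def)
  qed
qed

subsection \<open>Limits of pivots and oblique projections\<close>

lemma tendsto_matrix_mult [tendsto_intros]:
  fixes f :: "'a \<Rightarrow> real ^ 'n ^ 'm" and g :: "'a \<Rightarrow> real ^ 'k ^ 'n"
  assumes "(f \<longlongrightarrow> A) F" "(g \<longlongrightarrow> B) F"
  shows "((\<lambda>x. f x ** g x) \<longlongrightarrow> A ** B) F"
  unfolding matrix_matrix_mult_def using assms by (intro tendsto_intros)

lemma tendsto_transpose [tendsto_intros]: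
  fixes f :: "'a \<Rightarrow> real ^ 'n ^ 'm"
  assumes "(f \<longlongrightarrow> A) F"
  shows "((\<lambda>x. transpose (f x)) \<longlongrightarrow> transpose A) F"
  unfolding transpose_def using assms by (intro tendsto_intros)

lemma tendsto_det [tendsto_intros]:
  fixes f :: "'a \<Rightarrow> real ^ 'n ^ 'n"
  assumes "(f \<longlongrightarrow> A) F"
  shows "((\<lambda>x. det (f x)) \<longlongrightarrow> det A) F"
  unfolding det_def using assms by (intro tendsto_intros)

lemma
  fixes A :: "real ^ 'n ^ 'n"
  assumes "invertible A"
  shows matrix_inv_right: "A ** matrix_inv A = mat 1" and matrix_inv_left: "matrix_inv A ** A = mat 1"
proof -
  have "A ** matrix_inv A = mat 1 \<and> matrix_inv A ** A = mat 1"
    unfolding matrix_inv_def by (rule someI_ex) (use assms in \<open>simp add: invertible_def\<close>)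
  then show "A ** matrix_inv A = mat 1" "matrix_inv A ** A = mat 1"
    by auto
qed

lemma matrix_inv_eqI:
  fixes A :: "real ^ 'n ^ 'n"
  assumes "A ** B = mat 1"
  shows "matrix_inv A = B"
proof -
  have "invertible A"
    using assms invertible_right_inverse by blast
  then have "matrix_inv A ** (A ** B) = B"
    by (simp add: matrix_mul_assoc matrix_inv_left)
  with assms show ?thesis
    by simp
qed

text \<open>Entries as quotients of determinants reduce continuity of inversion to continuity of
  polynomials.\<close>

lemma matrix_inv_cramer:
  fixes A :: "real ^ 'n ^ 'n"
  assumes "det A \<noteq> 0"
  shows "matrix_inv A = (\<chi> k l. det (\<chi> i j. if j = k then axis l 1 $ i else A $ i $ j) / det A)"
proof -
  have "A *v (matrix_inv A *v axis l 1) = axis l 1" for l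
    using assms by (simp add: matrix_vector_mul_assoc matrix_inv_right invertible_det_nz)
  then have "matrix_inv A *v axis l 1 = (\<chi> k. det (\<chi> i j. if j = k then axis l 1 $ i else A $ i $ j) / det A)" for l
    using cramer[OF assms] by blast
  then show ?thesis
    by (simp add: vec_eq_iff matrix_vector_mult_basis column_def)
qed

lemma tendsto_matrix_inv:
  fixes f :: "'a \<Rightarrow> real ^ 'n ^ 'n"
  assumes f: "(f \<longlongrightarrow> A) F" and A: "invertible A"
  shows "((\<lambda>x. matrix_inv (f x)) \<longlongrightarrow> matrix_inv A) F"
proof -
  let ?c = "\<lambda>A :: real ^ 'n ^ 'n. \<chi> k l. det (\<chi> i j. if j = k then axis l 1 $ i else A $ i $ j) / det A"
  have dA: "det A \<noteq> 0"
    using A by (simp add: invertible_det_nz)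
  have lim: "((\<lambda>x. if j = k then c else f x $ i $ j) \<longlongrightarrow> (if j = k then c else A $ i $ j)) F" for i j k c
    using f by (auto intro!: tendsto_intros)
  have "((\<lambda>x. ?c (f x)) \<longlongrightarrow> ?c A) F"
    using dA f by (intro tendsto_intros lim)
  moreover have "\<forall>\<^sub>F x in F. det (f x) \<noteq> 0"
    using tendsto_imp_eventually_ne[OF tendsto_det[OF f] dA] .
  then have "\<forall>\<^sub>F x in F. ?c (f x) = matrix_inv (f x)"
    by eventually_elim (simp add: matrix_inv_cramer)
  ultimately show ?thesis
    unfolding matrix_inv_cramer[OF dA] by (rule Lim_transform_eventually)
qed

section \<open>Stability of feasibility under limits\<close>

lemma row_eq_nth: "row i A = A $ i"
  by (simp add: row_def)

text \<open>Normalising the pivot row is continuous only away from 0.\<close>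

lemma tendsto_deflate:
  fixes f :: "'a \<Rightarrow> real ^ 'r ^ 'm"
  assumes f: "(f \<longlongrightarrow> A) F" and i: "row i A \<noteq> 0"
  shows "((\<lambda>x. deflate (f x) i) \<longlongrightarrow> deflate A i) F"
proof (rule vec_tendstoI)
  fix j
  have *: "((\<lambda>x. row l (f x)) \<longlongrightarrow> row l A) F" for l
    unfolding row_eq_nth using f by (rule tendsto_vec_nth)
  have "((\<lambda>x. row j (deflate (f x) i)) \<longlongrightarrow> row j (deflate A i)) F"
    unfolding row_deflate using i by (intro tendsto_intros *) auto
  then show "((\<lambda>x. deflate (f x) i $ j) \<longlongrightarrow> deflate A i $ j) F"
    by (simp add: row_eq_nth)
qed

lemma max_rows_residual_nonzero:
  fixes U :: "real ^ 'r ^ 'm"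
  assumes U: "orthonormal_columns U" and k: "k < CARD('r)"
    and p: "p k \<in> max_rows (qdeim_residual U p k)"
  shows "row (p k) (qdeim_residual U p k) \<noteq> 0"
proof -
  obtain j where "0 < peak (range ((*v) U)) (p ` {..<k}) j"
    using exists_peak_pos[OF orthonormal_inj[OF U] k] .
  then have "0 < norm (row j (qdeim_residual U p k))"
    by (simp add: norm_qdeim_residual[OF U])
  also have "\<dots> \<le> norm (row (p k) (qdeim_residual U p k))"
    using p by (simp add: max_rows_iff)
  finally show ?thesis
    by simp
qed

text \<open>For a fixed pivot sequence the maximality inequalities are closed conditions.
  Convergence of the residuals is carried along by induction: the limiting inequality makes the
  pivot row maximal, hence nonzero, which makes the next deflation continuous.\<close>

lemma qdeim_feasible_limit:
  fixes U :: "real ^ 'r ^ 'm"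
  assumes f: "(f \<longlongrightarrow> U) F" and F: "F \<noteq> bot" and U: "orthonormal_columns U"
    and p: "\<And>x. qdeim_feasible (f x) p"
  shows "qdeim_feasible U p"
proof -
  have step: "p k \<in> max_rows (qdeim_residual U p k)"
    if "k < CARD('r)" "((\<lambda>x. qdeim_residual (f x) p k) \<longlongrightarrow> qdeim_residual U p k) F" for k
    unfolding max_rows_iff
  proof
    fix j
    have *: "((\<lambda>x. norm (row l (qdeim_residual (f x) p k))) \<longlongrightarrow> norm (row l (qdeim_residual U p k))) F" for l
      unfolding row_eq_nth using that(2) by (intro tendsto_intros)
    show "norm (row j (qdeim_residual U p k)) \<le> norm (row (p k) (qdeim_residual U p k))"
      using p that(1) by (intro tendsto_le[OF F * *]) (auto simp: qdeim_feasible_def max_rows_iff)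
  qed
  have "((\<lambda>x. qdeim_residual (f x) p k) \<longlongrightarrow> qdeim_residual U p k) F" if "k \<le> CARD('r)" for k
    using that
  proof (induction k)
    case (Suc k)
    then show ?case
      using step[of k] max_rows_residual_nonzero[OF U, of k p] by (auto intro!: tendsto_deflate)
  qed (simp add: f)
  then show ?thesis
    using step by (simp add: qdeim_feasible_def)
qed

section \<open>Selection matrices and their oblique projections\<close>

lemma range_position:
  "range (\<lambda>j :: 'r::{finite,linorder}. card {..<j}) = {..<CARD('r)}"
proof (rule card_subset_eq)
  have "card {..<i} \<noteq> card {..<j}" if "i < j" for i j :: 'r
    using psubset_card_mono[of "{..<j}" "{..<i}"] that by (auto simp: less_le_not_le)
  then have "inj (\<lambda>j :: 'r. card {..<j})"
    by (metis injI linorder_less_linear)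
  then show "card (range (\<lambda>j :: 'r. card {..<j})) = card {..<CARD('r)}"
    by (simp add: card_image)
  show "range (\<lambda>j :: 'r. card {..<j}) \<subseteq> {..<CARD('r)}"
    by (auto intro!: psubset_card_mono)
qed simp

text \<open>A positive peak yields an \<open>x\<close> orthogonal to the earlier pivot rows but not
  to the next one. So the r pivot rows are independent and span the whole space; they are the rows
  of the product.\<close>

lemma selection_invertible:
  fixes U :: "real ^ 'r::{finite,linorder} ^ 'm"
  assumes U: "orthonormal_columns U" and p: "qdeim_feasible U p"
  shows "invertible (transpose (selection_matrix p :: real ^ 'r::{finite,linorder} ^ 'm) ** U)"
proof -
  let ?R = "range ((*v) U)" and ?S = "selection_matrix p :: real ^ 'r::{finite,linorder} ^ 'm"
  define a where "a k = U $ p k" for k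
  have g: "greedy ?R CARD('r) p"
    using p by (simp add: qdeim_feasible_iff_greedy[OF U])
  have "dim (a ` {..<k}) = k" if "k \<le> CARD('r)" for k
    using that
  proof (induction k)
    case (Suc k)
    then have k: "k < CARD('r)"
      by simp
    obtain x where x: "\<And>i. i < k \<Longrightarrow> a i \<bullet> x = 0" "a k \<bullet> x \<noteq> 0"
      using greedy_peak_pos[OF orthonormal_inj[OF U] g k]
      by (auto simp: peak_pos_iff[OF subspace_range_mat] matrix_vector_mul_component a_def)
    have "v \<bullet> x = 0" if "v \<in> span (a ` {..<k})" for v
      using that
    proof (induction rule: span_induct)
      case base
      show ?case
        by (simp add: subspace_def inner_add_left)
    qed (use x in auto)
    with x(2) have "a k \<notin> span (a ` {..<k})"
      by blast
    then show ?case
      using Suc by (simp add: lessThan_Suc dim_insert)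
  qed simp
  then have full: "span (a ` {..<CARD('r)}) = UNIV"
    by (simp flip: dim_eq_full)
  have "x = 0" if x: "(transpose ?S ** U) *v x = 0" for x
  proof -
    have "a (card {..<j}) \<bullet> x = 0" for j :: 'r
    proof -
      have "((transpose ?S ** U) *v x) $ j = a (card {..<j}) \<bullet> x"
        by (simp add: matrix_vector_mul_assoc[symmetric] selection_matrix_def matrix_vector_mul_component
            inner_axis' a_def del: transpose_matrix_vector)
      with x show ?thesis
        by simp
    qed
    then have a0: "a k \<bullet> x = 0" if "k < CARD('r)" for k
      using that range_position[where 'r = 'r] by (metis imageE lessThan_iff)
    have "v \<bullet> x = 0" if "v \<in> span (a ` {..<CARD('r)})" for v
      using that
    proof (induction rule: span_induct)
      case base
      show ?case
        by (simp add: subspace_def inner_add_left)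
    qed (use a0 in auto)
    then show "x = 0"
      using full by (metis UNIV_I inner_eq_zero_iff)
  qed
  then show ?thesis
    using invertible_left_inverse matrix_left_invertible_ker by blast
qed

text \<open>\<open>Q\<close> cancels against its inverse, so the projection sees only the range of
  \<open>U\<close> and the selection.\<close>

lemma column_oblique_mult_right:
  fixes U :: "real ^ 'r ^ 'm" and Q :: "real ^ 'r ^ 'r"
  assumes Q: "invertible Q" and S: "invertible (transpose S ** U)"
  shows "column_oblique (U ** Q) S = column_oblique U S"
proof -
  have "(transpose S ** (U ** Q)) ** (matrix_inv Q ** matrix_inv (transpose S ** U)) =
      (transpose S ** U) ** (Q ** matrix_inv Q) ** matrix_inv (transpose S ** U)"
    by (simp only: matrix_mul_assoc)
  then have "matrix_inv (transpose S ** (U ** Q)) = matrix_inv Q ** matrix_inv (transpose S ** U)"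
    using Q S by (intro matrix_inv_eqI) (simp add: matrix_inv_right)
  then have "column_oblique (U ** Q) S =
      U ** (Q ** matrix_inv Q) ** matrix_inv (transpose S ** U) ** transpose S"
    by (simp only: column_oblique_def matrix_mul_assoc)
  then show ?thesis
    by (simp add: matrix_inv_right[OF Q] column_oblique_def)
qed

text \<open>Lets results on column spaces serve for row spaces, applied to the transposed
  matrix.\<close>

lemma row_oblique_eq_transpose:
  fixes V :: "real ^ 'r ^ 'n"
  assumes "invertible (transpose S ** V)"
  shows "row_oblique V S = transpose (column_oblique V S)"
proof -
  have "(transpose V ** S) ** transpose (matrix_inv (transpose S ** V)) =
      transpose (matrix_inv (transpose S ** V) ** (transpose S ** V))"
    by (simp add: matrix_transpose_mul)
  then have "matrix_inv (transpose V ** S) = transpose (matrix_inv (transpose S ** V))"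
    using assms by (intro matrix_inv_eqI) (simp add: matrix_inv_left)
  then show ?thesis
    by (simp add: row_oblique_def column_oblique_def matrix_transpose_mul matrix_mul_assoc)
qed

lemma range_mult_invertible:
  fixes U :: "real ^ 'r ^ 'm" and Q :: "real ^ 'r ^ 'r"
  assumes "invertible Q"
  shows "range ((*v) (U ** Q)) = range ((*v) U)"
proof -
  have "surj ((*v) Q)"
    using assms matrix_right_invertible_surjective by (auto simp: invertible_def)
  then have "range (\<lambda>x. U *v (Q *v x)) = range ((*v) U)"
    by (simp flip: image_image)
  then show ?thesis
    by (simp add: matrix_vector_mul_assoc)
qed

text \<open>Limits of orthonormal bases are known only up to a change of basis \<open>Q\<close>;
  feasibility and the projection depend on the range alone, so both can be stated for
  \<open>U\<close>.\<close>

lemma column_oblique_limit: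
  fixes U :: "real ^ 'r::{finite,linorder} ^ 'm"
    and Q :: "real ^ 'r::{finite,linorder} ^ 'r::{finite,linorder}"
  assumes f: "(f \<longlongrightarrow> U ** Q) F" and F: "F \<noteq> bot"
    and U: "orthonormal_columns U" "orthonormal_columns (U ** Q)" and Q: "invertible Q"
    and p: "\<And>x. qdeim_feasible (f x) p"
  shows "qdeim_feasible U p"
    and "((\<lambda>x. column_oblique (f x) (selection_matrix p)) \<longlongrightarrow> column_oblique U (selection_matrix p)) F"
proof -
  have p': "qdeim_feasible (U ** Q) p"
    using qdeim_feasible_limit[OF f F U(2) p] .
  then show pU: "qdeim_feasible U p"
    by (simp add: qdeim_feasible_iff_greedy[OF U(1)] qdeim_feasible_iff_greedy[OF U(2)]
        range_mult_invertible[OF Q])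
  have "((\<lambda>x. column_oblique (f x) (selection_matrix p)) \<longlongrightarrow> column_oblique (U ** Q) (selection_matrix p)) F"
    unfolding column_oblique_def
    by (intro tendsto_intros tendsto_matrix_inv f selection_invertible[OF U(2) p'])
  then show "((\<lambda>x. column_oblique (f x) (selection_matrix p)) \<longlongrightarrow> column_oblique U (selection_matrix p)) F"
    by (simp add: column_oblique_mult_right[OF Q selection_invertible[OF U(1) pU]])
qed

subsection \<open>Perturbations and subsequences\<close>

lemma range_matrix_mult: "range ((*v) (A ** B)) = (*v) A ` range ((*v) B)"
  for A :: "real ^ 'n ^ 'm"
  by (simp add: image_image matrix_vector_mul_assoc)

lemma tendsto_dist_less_inverse:
  fixes A :: "nat \<Rightarrow> 'a::metric_space"
  assumes "\<And>n. dist (A n) a < inverse (real (Suc n))"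
  shows "A \<longlonglongrightarrow> a"
  using assms by (intro metric_tendsto_imp_tendsto[OF LIMSEQ_inverse_real_of_nat])
    (auto intro!: always_eventually less_imp_le simp del: of_nat_Suc)

text \<open>\<open>A\<close> is a tilt followed by a diagonal scaling, each costing at most half of
  \<epsilon>. The normal vector for the tilt exists because the range has dimension r, which is less
  than m.\<close>

lemma strictly_greedy_perturbation:
  fixes U :: "real ^ 'r ^ 'm"
  assumes U: "orthonormal_columns U" and less: "CARD('r) < CARD('m)"
    and p: "greedy (range ((*v) U)) CARD('r) p" and \<epsilon>: "0 < \<epsilon>"
  obtains A :: "real ^ 'm ^ 'm"
  where "dist A (mat 1) < \<epsilon>" "strictly_greedy (range ((*v) (A ** U))) CARD('r) p"
proof -
  let ?R = "range ((*v) U)"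
  have R: "subspace ?R"
    by (rule subspace_range_mat)
  have pos: "0 < peak ?R (p ` {..<k}) (p k)" if "k < CARD('r)" for k
    using greedy_peak_pos[OF orthonormal_inj[OF U] p that] .
  have "dim ?R < DIM(real ^ 'm)"
    using less full_rank_injective[of U] orthonormal_inj[OF U] by (simp flip: rank_dim_range)
  then obtain w0 where w0: "w0 \<noteq> 0" "\<And>y. y \<in> span ?R \<Longrightarrow> orthogonal w0 y"
    by (rule orthogonal_to_subspace_exists) blast
  define w where "w = w0 /\<^sub>R norm w0"
  have w: "norm w = 1" "\<And>z. z \<in> ?R \<Longrightarrow> z \<bullet> w = 0"
    using w0 by (auto simp: w_def orthogonal_def inner_commute span_base)
  define T where "T = {j. axis j 1 \<in> ?R}"
  have "(tilt T w \<longlongrightarrow> mat 1 + 0 *\<^sub>R (\<chi> i j. if j \<in> T then w $ i else 0)) (at_right 0)"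
    unfolding tilt_def by (intro tendsto_intros)
  then have "\<forall>\<^sub>F t in at_right 0. dist (tilt T w t) (mat 1) < \<epsilon> / 2"
    using \<epsilon> by (intro tendstoD) auto
  moreover have "\<forall>\<^sub>F t in at_right 0. greedy ((*v) (tilt T w t) ` ?R) CARD('r) p \<and>
      (\<forall>j. axis j 1 \<notin> (*v) (tilt T w t) ` ?R)"
    using tilt_greedy[OF R p pos w(2,1)] unfolding T_def by blast
  ultimately have "\<forall>\<^sub>F t in at_right 0. dist (tilt T w t) (mat 1) < \<epsilon> / 2 \<and>
      greedy ((*v) (tilt T w t) ` ?R) CARD('r) p \<and> (\<forall>j. axis j 1 \<notin> (*v) (tilt T w t) ` ?R)"
    by eventually_elim blast
  then obtain t where t: "dist (tilt T w t) (mat 1) < \<epsilon> / 2"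
      "greedy ((*v) (tilt T w t) ` ?R) CARD('r) p" "\<And>j. axis j 1 \<notin> (*v) (tilt T w t) ` ?R"
    using eventually_happens'[OF trivial_limit_at_right_real] by blast
  let ?B = "tilt T w t"
  \<comment> \<open>The tilt is injective on the range of \<open>U\<close>: pairing with
    \<open>U *v x\<close> removes the part along \<open>w\<close>.\<close>
  have "x = 0" if "(?B ** U) *v x = 0" for x
  proof -
    have "U *v x + (t * (\<Sum>j\<in>T. (U *v x) $ j)) *\<^sub>R w = 0"
      using that by (simp add: tilt_mult_vec flip: matrix_vector_mul_assoc)
    then have "(U *v x) \<bullet> (U *v x + (t * (\<Sum>j\<in>T. (U *v x) $ j)) *\<^sub>R w) = 0"
      by simp
    then show "x = 0"
      using w(2)[of "U *v x"] by (simp add: inner_add_right orthonormal_inner[OF U])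
  qed
  then have inj: "inj ((*v) (?B ** U))"
    using matrix_left_invertible_injective matrix_left_invertible_ker by blast
  obtain e where e: "\<And>\<delta>. 1 < \<delta> \<Longrightarrow>
      strictly_greedy ((*v) (diag (\<lambda>i. \<delta> ^ e i)) ` range ((*v) (?B ** U))) CARD('r) p"
  proof (rule diag_strictly_greedy)
    show "subspace (range ((*v) (?B ** U)))"
      by (rule subspace_range_mat)
    show g: "greedy (range ((*v) (?B ** U))) CARD('r) p"
      using t by (simp add: range_matrix_mult)
    show "0 < peak (range ((*v) (?B ** U))) (p ` {..<k}) (p k)" if "k < CARD('r)" for k
      using greedy_peak_pos[OF inj g that] .
    show "axis j 1 \<notin> range ((*v) (?B ** U))" for j
      using t by (simp add: range_matrix_mult)
  qed blast
  have "((\<lambda>\<delta>. if i = j then \<delta> ^ e i else 0) \<longlongrightarrow> (if i = j then 1 ^ e i else 0)) (at_right (1::real))" for i j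
    by (cases "i = j") (auto intro!: tendsto_eq_intros)
  then have "((\<lambda>\<delta>. diag (\<lambda>i. \<delta> ^ e i) ** ?B) \<longlongrightarrow> diag (\<lambda>i. 1 ^ e i) ** ?B) (at_right (1::real))"
    unfolding diag_def by (intro tendsto_intros)
  moreover have "diag (\<lambda>i. 1 ^ e i) = (mat 1 :: real ^ 'm ^ 'm)"
    by (simp add: diag_def mat_def)
  ultimately have "((\<lambda>\<delta>. diag (\<lambda>i. \<delta> ^ e i) ** ?B) \<longlongrightarrow> ?B) (at_right (1::real))"
    by simp
  then have "\<forall>\<^sub>F \<delta> in at_right 1. dist (diag (\<lambda>i. \<delta> ^ e i) ** ?B) ?B < \<epsilon> / 2"
    using \<epsilon> by (intro tendstoD) auto
  moreover have "\<forall>\<^sub>F \<delta> :: real in at_right 1. 1 < \<delta>"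
    by (simp add: eventually_at_right_less)
  ultimately have "\<forall>\<^sub>F \<delta> in at_right 1. dist (diag (\<lambda>i. \<delta> ^ e i) ** ?B) ?B < \<epsilon> / 2 \<and> 1 < \<delta>"
    by (rule eventually_conj)
  then obtain \<delta> where \<delta>: "dist (diag (\<lambda>i. \<delta> ^ e i) ** ?B) ?B < \<epsilon> / 2" "1 < \<delta>"
    using eventually_happens'[OF trivial_limit_at_right_real] by blast
  show thesis
  proof (rule that)
    have "dist (mat 1) ?B < \<epsilon> / 2"
      using t(1) by (simp only: dist_commute)
    with \<delta>(1) show "dist (diag (\<lambda>i. \<delta> ^ e i) ** ?B) (mat 1) < \<epsilon>"
      by (rule dist_triangle_half_l)
    show "strictly_greedy (range ((*v) (diag (\<lambda>i. \<delta> ^ e i) ** ?B ** U))) CARD('r) p"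
      using e[OF \<delta>(2)]
      by (simp only: range_matrix_mult[of "diag _" "?B ** U"] flip: matrix_mul_assoc)
  qed
qed

lemma strictly_greedy_perturbation_sequence:
  fixes U :: "real ^ 'r ^ 'm"
  assumes "orthonormal_columns U" "CARD('r) < CARD('m)" "qdeim_feasible U p"
  obtains A :: "nat \<Rightarrow> real ^ 'm ^ 'm"
  where "A \<longlonglongrightarrow> mat 1" "\<And>n. invertible (A n)"
    "\<And>n. strictly_greedy (range ((*v) (A n ** U))) CARD('r) p"
proof -
  have g: "greedy (range ((*v) U)) CARD('r) p"
    using assms by (simp add: qdeim_feasible_iff_greedy)
  have "\<exists>A. dist A (mat 1) < inverse (real (Suc n)) \<and>
      strictly_greedy (range ((*v) (A ** U))) CARD('r) p" for n
    using strictly_greedy_perturbation[OF assms(1,2) g, of "inverse (real (Suc n))"]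
    by (metis inverse_positive_iff_positive of_nat_0_less_iff zero_less_Suc)
  then obtain A :: "nat \<Rightarrow> real ^ 'm ^ 'm" where
      A: "\<And>n. dist (A n) (mat 1) < inverse (real (Suc n))"
        "\<And>n. strictly_greedy (range ((*v) (A n ** U))) CARD('r) p"
    by metis
  have lim: "A \<longlonglongrightarrow> mat 1"
    using A(1) by (rule tendsto_dist_less_inverse)
  \<comment> \<open>The determinants tend to 1, so dropping finitely many terms makes all
    perturbations invertible.\<close>
  then have "\<forall>\<^sub>F n in sequentially. det (A n) \<noteq> 0"
    using tendsto_imp_eventually_ne[OF tendsto_det[OF lim], of 0] by simp
  then obtain N where "\<And>n. N \<le> n \<Longrightarrow> det (A n) \<noteq> 0"
    by (auto simp: eventually_sequentially)
  then show thesis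
    using A(2) LIMSEQ_ignore_initial_segment[OF lim, of N]
    by (intro that[of "\<lambda>n. A (n + N)"]) (auto simp: invertible_det_nz)
qed

section \<open>Orthonormal factors of a matrix of rank r\<close>

definition rank_factors :: "real ^ 'n ^ 'm \<Rightarrow> real ^ 'r ^ 'm \<Rightarrow> real ^ 'r ^ 'n \<Rightarrow> bool" where
  "rank_factors X U V \<longleftrightarrow> orthonormal_columns U \<and> orthonormal_columns V \<and>
    (\<exists>\<Sigma> :: real ^ 'r ^ 'r. X = U ** \<Sigma> ** transpose V)"

lemma rank_factors_transpose: "rank_factors X U V \<Longrightarrow> rank_factors (transpose X) V U"
  unfolding rank_factors_def
  by (metis matrix_mul_assoc matrix_transpose_mul transpose_transpose)

lemma orthonormal_basis_matrix:
  fixes S :: "(real ^ 'm) set"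
  assumes S: "subspace S" and dim: "dim S = CARD('r::finite)"
  obtains U :: "real ^ 'r ^ 'm" where "orthonormal_columns U" "S \<subseteq> range ((*v) U)"
proof -
  obtain B where B: "pairwise orthogonal B" "\<And>x. x \<in> B \<Longrightarrow> norm x = 1" "independent B"
      "card B = dim S" "span B = S"
    using orthonormal_basis_subspace[OF S] by metis
  have "finite B"
    using B(3) by (rule independent_imp_finite)
  then obtain f :: "'r \<Rightarrow> real ^ 'm" where f: "bij_betw f UNIV B"
    using B(4) dim finite_same_card_bij[of "UNIV :: 'r set" B] by auto
  define U :: "real ^ 'r ^ 'm" where "U = (\<chi> i j. f j $ i)"
  have col: "column j U = f j" for j
    by (simp add: U_def column_def)
  have "f i \<bullet> f j = (if i = j then 1 else 0)" for i j
  proof (cases "i = j")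
    case True
    then show ?thesis
      using f B(2) by (auto simp: dot_square_norm bij_betw_def)
  next
    case False
    with f have "f i \<in> B" "f j \<in> B" "f i \<noteq> f j"
      by (auto simp: bij_betw_def inj_def)
    then show ?thesis
      using B(1) False by (auto simp: pairwise_def orthogonal_def)
  qed
  then have "orthonormal_columns U"
    by (simp add: orthonormal_columns_def matrix_mult_transpose_dot_column col mat_def)
  moreover have "B \<subseteq> range ((*v) U)"
  proof
    fix b assume "b \<in> B"
    then obtain j where "b = f j"
      using f by (auto simp: bij_betw_def)
    then have "b = U *v axis j 1"
      by (simp add: matrix_vector_mult_basis col)
    then show "b \<in> range ((*v) U)"
      by blast
  qed
  then have "S \<subseteq> range ((*v) U)"
    using span_minimal[OF _ subspace_range_mat] B(5) by blast
  ultimately show thesis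
    by (rule that)
qed

lemma orthonormal_projection:
  fixes U :: "real ^ 'r ^ 'm" and X :: "real ^ 'n ^ 'm"
  assumes U: "orthonormal_columns U" and X: "range ((*v) X) \<subseteq> range ((*v) U)"
  shows "U ** (transpose U ** X) = X"
  unfolding matrix_eq
proof
  fix x
  obtain z where z: "X *v x = U *v z"
    using X by blast
  have "(U ** (transpose U ** X)) *v x = U *v (transpose U *v (X *v x))"
    by (simp only: matrix_vector_mul_assoc)
  also have "transpose U *v (X *v x) = z"
    unfolding z using U by (simp only: orthonormal_columns_def matrix_vector_mul_assoc matrix_vector_mul_lid)
  finally show "(U ** (transpose U ** X)) *v x = X *v x"
    by (simp add: z)
qed

text \<open>Take orthonormal bases of the column and row spaces, with
  \<open>transpose U ** X ** V\<close> in the middle. This makes the choice in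
  \<open>oblique_proj\<close> meaningful.\<close>

lemma rank_factors_exist:
  fixes X :: "real ^ 'n ^ 'm"
  assumes "rank X = CARD('r::finite)"
  obtains U :: "real ^ 'r ^ 'm" and V :: "real ^ 'r ^ 'n" where "rank_factors X U V"
proof -
  obtain U :: "real ^ 'r ^ 'm" where U: "orthonormal_columns U" "range ((*v) X) \<subseteq> range ((*v) U)"
    using orthonormal_basis_matrix[OF subspace_range_mat[of X]] assms by (metis rank_dim_range)
  obtain V :: "real ^ 'r ^ 'n" where V: "orthonormal_columns V"
      "range ((*v) (transpose X)) \<subseteq> range ((*v) V)"
    using orthonormal_basis_matrix[OF subspace_range_mat[of "transpose X"]] assms
    by (metis rank_dim_range rank_transpose)
  have "X = transpose (V ** (transpose V ** transpose X))"
    by (simp add: orthonormal_projection[OF V])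
  also have "\<dots> = X ** V ** transpose V"
    by (simp add: matrix_transpose_mul)
  also have "\<dots> = U ** (transpose U ** X) ** V ** transpose V"
    by (simp only: orthonormal_projection[OF U])
  finally have "X = U ** (transpose U ** X ** V) ** transpose V"
    by (simp only: matrix_mul_assoc)
  then show thesis
    using U V that unfolding rank_factors_def by blast
qed

text \<open>Full rank makes \<Sigma> invertible, so \<open>U\<close> equals
  \<open>X ** V ** matrix_inv \<Sigma>\<close> and thus factors through any \<open>U'\<close> that
  \<open>X\<close> factors through. \<open>Q\<close> is invertible since
  \<open>transpose U ** U'\<close> inverts it from the left.\<close>

lemma rank_factors_basis_change:
  fixes X :: "real ^ 'n ^ 'm" and U U' :: "real ^ 'r ^ 'm" and M :: "real ^ 'n ^ 'r"
  assumes X: "rank_factors X U V" "rank X = CARD('r)" and U': "X = U' ** M"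
  obtains Q :: "real ^ 'r ^ 'r" where "invertible Q" "U = U' ** Q"
proof -
  obtain \<Sigma> :: "real ^ 'r ^ 'r" where \<Sigma>: "X = U ** \<Sigma> ** transpose V"
    and U: "transpose U ** U = mat 1" and V: "transpose V ** V = mat 1"
    using X(1) by (auto simp: rank_factors_def orthonormal_columns_def)
  have "rank X \<le> rank \<Sigma>"
    unfolding \<Sigma> using rank_mul_le_left rank_mul_le_right order_trans by metis
  then have "rank \<Sigma> = CARD('r)"
    using X(2) rank_bound[of \<Sigma>] by simp
  then have inv: "invertible \<Sigma>"
    using full_rank_injective invertible_left_inverse matrix_left_invertible_injective by blast
  define Q where "Q = M ** V ** matrix_inv \<Sigma>"
  have "U' ** Q = X ** V ** matrix_inv \<Sigma>"
    by (simp only: Q_def U' matrix_mul_assoc)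
  also have "\<dots> = U ** (\<Sigma> ** (transpose V ** V) ** matrix_inv \<Sigma>)"
    by (simp only: \<Sigma> matrix_mul_assoc)
  also have "\<dots> = U"
    by (simp add: V matrix_inv_right[OF inv])
  finally have Q: "U = U' ** Q" ..
  have "(transpose U ** U') ** Q = mat 1"
    using U by (simp add: Q flip: matrix_mul_assoc)
  then have "invertible Q"
    using invertible_left_inverse by blast
  with Q that show thesis
    by blast
qed

lemma bounded_orthonormal_columns: "bounded {U :: real ^ 'r ^ 'm. orthonormal_columns U}"
proof (rule boundedI)
  fix U :: "real ^ 'r ^ 'm" assume "U \<in> {U. orthonormal_columns U}"
  then have U: "orthonormal_columns U"
    by simp
  have "norm (U $ i) \<le> 1" for i
  proof -
    \<comment> \<open>Applying \<open>U\<close> to its own row turns the squared row norm into a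
      component of a vector of that same norm.\<close>
    have "U $ i \<bullet> U $ i = (U *v (U $ i)) $ i"
      by (simp add: matrix_vector_mul_component)
    also have "\<dots> \<le> norm (U $ i)"
      using component_le_norm_cart[of "U *v (U $ i)" i] by (simp add: orthonormal_norm[OF U])
    finally show ?thesis
      by (cases "U $ i = 0") (auto simp: dot_square_norm power2_eq_square)
  qed
  then have "(\<Sum>i\<in>UNIV. norm (U $ i)) \<le> (\<Sum>i::'m\<in>UNIV. 1)"
    by (intro sum_mono)
  then show "norm U \<le> real CARD('m)"
    using L2_set_le_sum[of UNIV "\<lambda>i. norm (U $ i)"] by (simp add: norm_vec_def[of U])
qed

lemma greedy_cong: "(\<And>k. k < r \<Longrightarrow> p k = q k) \<Longrightarrow> greedy R r p \<longleftrightarrow> greedy R r q"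
proof -
  assume pq: "\<And>k. k < r \<Longrightarrow> p k = q k"
  then have "p ` {..<k} = q ` {..<k}" if "k < r" for k
    using that by (intro image_cong) auto
  with pq show ?thesis
    by (simp add: greedy_def)
qed

text \<open>Two extractions: compactness makes the bases converge, and the pigeonhole principle
  makes the selected pivots constant.\<close>

lemma column_oblique_subsequence:
  fixes U :: "real ^ 'r::{finite,linorder} ^ 'm::{finite,linorder}"
    and Us :: "nat \<Rightarrow> real ^ 'r::{finite,linorder} ^ 'm::{finite,linorder}"
  assumes lim: "X \<longlonglongrightarrow> Y" and rank: "rank Y = CARD('r)" and Y: "rank_factors Y U V"
    and X: "\<And>n. rank_factors (X n) (Us n) (Vs n)"
  obtains \<phi> p where "strict_mono \<phi>" "qdeim_feasible U p" "\<And>n. qdeim (Us (\<phi> n)) = selection_matrix p"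
    "(\<lambda>n. column_oblique (Us (\<phi> n)) (selection_matrix p)) \<longlonglongrightarrow> column_oblique U (selection_matrix p)"
proof -
  have orth: "orthonormal_columns (Us n)" for n
    using X by (simp add: rank_factors_def)
  then have "bounded (range Us)"
    by (intro bounded_subset[OF bounded_orthonormal_columns]) auto
  then obtain U' \<phi> where \<phi>: "strict_mono \<phi>" "(Us \<circ> \<phi>) \<longlonglongrightarrow> U'"
    using bounded_imp_convergent_subsequence by blast
  \<comment> \<open>Restricting to the first r steps leaves finitely many pivot sequences.\<close>
  let ?P = "\<lambda>n. restrict (qdeim_pivot (Us (\<phi> n))) {..<CARD('r)}"
  have "range ?P \<subseteq> {..<CARD('r)} \<rightarrow>\<^sub>E UNIV"
    by (intro image_subsetI restrict_PiE_iff[THEN iffD2]) simp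
  then have "finite (range ?P)"
    by (rule finite_subset) (simp add: finite_PiE)
  then obtain n0 where "infinite {n. ?P n = ?P n0}"
    using pigeonhole_infinite[of UNIV ?P] by auto
  then obtain \<psi> :: "nat \<Rightarrow> nat" where \<psi>: "strict_mono \<psi>" "\<And>n. ?P (\<psi> n) = ?P n0"
    using infinite_enumerate by blast
  define p where "p = qdeim_pivot (Us (\<phi> n0))"
  have same: "qdeim_pivot (Us (\<phi> (\<psi> n))) k = p k" if "k < CARD('r)" for n k
    using fun_cong[OF \<psi>(2)[of n], of k] that by (simp add: p_def)
  have feas: "qdeim_feasible (Us (\<phi> (\<psi> n))) p" for n
    using qdeim_pivot_feasible[of "Us (\<phi> (\<psi> n))"] greedy_cong[of "CARD('r)" "qdeim_pivot (Us (\<phi> (\<psi> n)))" p] same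
    by (simp add: qdeim_feasible_iff_greedy[OF orth])
  have sel: "qdeim (Us (\<phi> (\<psi> n))) = selection_matrix p" for n
    unfolding qdeim_eq by (rule selection_matrix_cong) (rule same)
  have lim_U: "(\<lambda>n. Us (\<phi> n)) \<longlonglongrightarrow> U'" and lim_X: "(\<lambda>n. X (\<phi> n)) \<longlonglongrightarrow> Y"
    using \<phi>(2) LIMSEQ_subseq_LIMSEQ[OF lim \<phi>(1)] by (simp_all add: o_def)
  have "(\<lambda>n. transpose (Us (\<phi> n)) ** Us (\<phi> n)) \<longlonglongrightarrow> transpose U' ** U'"
    by (intro tendsto_intros lim_U)
  then have U': "orthonormal_columns U'"
    using orth by (simp add: orthonormal_columns_def LIMSEQ_const_iff)
  have XU: "Us n ** (transpose (Us n) ** X n) = X n" for n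
  proof (rule orthonormal_projection[OF orth])
    obtain \<Sigma> :: "real ^ 'r::{finite,linorder} ^ 'r::{finite,linorder}"
      where "X n = Us n ** \<Sigma> ** transpose (Vs n)"
      using X by (auto simp: rank_factors_def)
    then show "range ((*v) (X n)) \<subseteq> range ((*v) (Us n))"
      by (auto simp flip: matrix_vector_mul_assoc simp del: transpose_matrix_vector)
  qed
  have "(\<lambda>n. Us (\<phi> n) ** (transpose (Us (\<phi> n)) ** X (\<phi> n))) \<longlonglongrightarrow> U' ** (transpose U' ** Y)"
    by (intro tendsto_intros lim_U lim_X)
  \<comment> \<open>The limit basis still reproduces \<open>Y\<close> by projection, so it differs
    from \<open>U\<close> by an invertible factor.\<close>
  then have "Y = U' ** (transpose U' ** Y)"
    unfolding XU using lim_X LIMSEQ_unique by blast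
  then obtain Q where Q: "invertible Q" "U = U' ** Q"
    using rank_factors_basis_change[OF Y rank] by blast
  then have U'_eq: "U' = U ** matrix_inv Q"
    by (simp add: matrix_inv_right flip: matrix_mul_assoc)
  have inv: "invertible (matrix_inv Q)"
    using Q(1) matrix_inv_right invertible_right_inverse matrix_inv_left by blast
  have lim': "(\<lambda>n. Us (\<phi> (\<psi> n))) \<longlonglongrightarrow> U ** matrix_inv Q"
    using LIMSEQ_subseq_LIMSEQ[OF \<phi>(2) \<psi>(1)] by (simp add: o_def U'_eq)
  have U: "orthonormal_columns U"
    using Y by (simp add: rank_factors_def)
  note limit = column_oblique_limit[OF lim' sequentially_bot U U'[unfolded U'_eq] inv feas]
  show thesis
  proof (rule that)
    show "strict_mono (\<phi> \<circ> \<psi>)"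
      using \<phi>(1) \<psi>(1) by (rule strict_mono_o)
  qed (use limit sel in simp_all)
qed

subsection \<open>The Filippov map\<close>

definition oblique_combination ::
    "real ^ 'm ^ 'm \<Rightarrow> real ^ 'n ^ 'n \<Rightarrow> real ^ 'n ^ 'm \<Rightarrow> real ^ 'n ^ 'm" where
  "oblique_combination P P' Z = P ** Z - P ** Z ** P' + Z ** P'"

lemma oblique_proj_eq:
  fixes X :: "real ^ 'n::{finite,linorder} ^ 'm::{finite,linorder}"
  assumes "rank X = CARD('r::{finite,linorder})"
  obtains U :: "real ^ 'r::{finite,linorder} ^ 'm::{finite,linorder}"
    and V :: "real ^ 'r::{finite,linorder} ^ 'n::{finite,linorder}"
  where "rank_factors X U V"
    "\<And>Z. oblique_proj TYPE('r) X Z =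
       oblique_combination (column_oblique U (qdeim U)) (row_oblique V (qdeim V)) Z"
proof -
  define c :: "(real ^ 'r::{finite,linorder} ^ 'm::{finite,linorder}) \<times>
      (real ^ 'r::{finite,linorder} ^ 'n::{finite,linorder})"
    where "c = (SOME (U, V). orthonormal_columns U \<and> orthonormal_columns V \<and>
      (\<exists>\<Sigma> :: real ^ 'r::{finite,linorder} ^ 'r::{finite,linorder}. X = U ** \<Sigma> ** transpose V))"
  obtain U0 :: "real ^ 'r::{finite,linorder} ^ 'm::{finite,linorder}"
    and V0 :: "real ^ 'r::{finite,linorder} ^ 'n::{finite,linorder}" where "rank_factors X U0 V0"
    using rank_factors_exist[OF assms] .
  then have "(case (U0, V0) of (U, V) \<Rightarrow> orthonormal_columns U \<and> orthonormal_columns V \<and>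
      (\<exists>\<Sigma> :: real ^ 'r::{finite,linorder} ^ 'r::{finite,linorder}. X = U ** \<Sigma> ** transpose V))"
    by (simp add: rank_factors_def)
  then have "case c of (U, V) \<Rightarrow> orthonormal_columns U \<and> orthonormal_columns V \<and>
      (\<exists>\<Sigma> :: real ^ 'r::{finite,linorder} ^ 'r::{finite,linorder}. X = U ** \<Sigma> ** transpose V)"
    unfolding c_def by (rule someI)
  then have "rank_factors X (fst c) (snd c)"
    by (simp add: rank_factors_def split_beta)
  then show thesis
    by (rule that) (simp add: oblique_proj_def oblique_combination_def Let_def split_beta flip: c_def)
qed

text \<open>The column result is applied to \<open>X\<close> and then, along the subsequence found,
  to the transposes. The factors are part of the conclusion so that \<open>p\<close> and
  \<open>q\<close> can later be identified.\<close>

lemma oblique_proj_subsequence: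
  fixes F :: "real ^ 'n::{finite,linorder} ^ 'm::{finite,linorder}
              \<Rightarrow> real ^ 'n::{finite,linorder} ^ 'm::{finite,linorder}"
    and U :: "real ^ 'r::{finite,linorder} ^ 'm::{finite,linorder}"
    and V :: "real ^ 'r::{finite,linorder} ^ 'n::{finite,linorder}"
  assumes lim: "X \<longlonglongrightarrow> Y" and rank: "\<And>n. rank (X n) = CARD('r)" "rank Y = CARD('r)"
    and Y: "rank_factors Y U V" and F: "continuous_on UNIV F"
  obtains \<phi> p q
    and Us :: "nat \<Rightarrow> real ^ 'r::{finite,linorder} ^ 'm::{finite,linorder}"
    and Vs :: "nat \<Rightarrow> real ^ 'r::{finite,linorder} ^ 'n::{finite,linorder}"
  where "strict_mono \<phi>" "qdeim_feasible U p" "qdeim_feasible V q"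
    "\<And>n. rank_factors (X n) (Us n) (Vs n)"
    "\<And>n. qdeim (Us (\<phi> n)) = selection_matrix p" "\<And>n. qdeim (Vs (\<phi> n)) = selection_matrix q"
    "(\<lambda>n. oblique_proj TYPE('r) (X (\<phi> n)) (F (X (\<phi> n)))) \<longlonglongrightarrow>
      oblique_combination (column_oblique U (selection_matrix p)) (row_oblique V (selection_matrix q)) (F Y)"
proof -
  have "\<exists>(U :: real ^ 'r::{finite,linorder} ^ 'm::{finite,linorder})
      (V :: real ^ 'r::{finite,linorder} ^ 'n::{finite,linorder}). rank_factors (X n) U V \<and>
      (\<forall>Z. oblique_proj TYPE('r) (X n) Z =
        oblique_combination (column_oblique U (qdeim U)) (row_oblique V (qdeim V)) Z)" for n
    using oblique_proj_eq[OF rank(1)[of n]] by metis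
  then obtain Us :: "nat \<Rightarrow> real ^ 'r::{finite,linorder} ^ 'm::{finite,linorder}"
    and Vs :: "nat \<Rightarrow> real ^ 'r::{finite,linorder} ^ 'n::{finite,linorder}" where
    X: "\<And>n. rank_factors (X n) (Us n) (Vs n)" and
    proj: "\<And>n Z. oblique_proj TYPE('r) (X n) Z = oblique_combination
      (column_oblique (Us n) (qdeim (Us n))) (row_oblique (Vs n) (qdeim (Vs n))) Z"
    by metis
  obtain \<phi> p where \<phi>: "strict_mono \<phi>" "qdeim_feasible U p"
      "\<And>n. qdeim (Us (\<phi> n)) = selection_matrix p"
      "(\<lambda>n. column_oblique (Us (\<phi> n)) (selection_matrix p)) \<longlonglongrightarrow> column_oblique U (selection_matrix p)"
    by (rule column_oblique_subsequence[OF lim rank(2) Y X]) (rule that)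
  have lim\<phi>: "(\<lambda>n. transpose (X (\<phi> n))) \<longlonglongrightarrow> transpose Y"
    using LIMSEQ_subseq_LIMSEQ[OF lim \<phi>(1)] by (intro tendsto_transpose) (simp add: o_def)
  obtain \<psi> q where \<psi>: "strict_mono \<psi>" "qdeim_feasible V q"
      "\<And>n. qdeim (Vs (\<phi> (\<psi> n))) = selection_matrix q"
      "(\<lambda>n. column_oblique (Vs (\<phi> (\<psi> n))) (selection_matrix q)) \<longlonglongrightarrow> column_oblique V (selection_matrix q)"
    by (rule column_oblique_subsequence[OF lim\<phi> rank(2)[folded rank_transpose[of Y]]
          rank_factors_transpose[OF Y] rank_factors_transpose[OF X]]) (rule that)
  let ?\<theta> = "\<phi> \<circ> \<psi>"
  have \<theta>: "strict_mono ?\<theta>"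
    using \<phi>(1) \<psi>(1) by (rule strict_mono_o)
  have orth: "orthonormal_columns V" "orthonormal_columns (Vs n)" for n
    using X[of n] Y by (simp_all add: rank_factors_def)
  have "row_oblique (Vs n) (qdeim (Vs n)) = transpose (column_oblique (Vs n) (qdeim (Vs n)))" for n
    unfolding qdeim_eq
    by (intro row_oblique_eq_transpose selection_invertible orth qdeim_pivot_feasible)
  then have rows: "(\<lambda>n. row_oblique (Vs (?\<theta> n)) (selection_matrix q)) =
      (\<lambda>n. transpose (column_oblique (Vs (?\<theta> n)) (selection_matrix q)))"
    using \<psi>(3) by (metis comp_apply)
  have row: "row_oblique V (selection_matrix q) = transpose (column_oblique V (selection_matrix q))"
    by (intro row_oblique_eq_transpose selection_invertible orth \<psi>(2))
  have P': "(\<lambda>n. row_oblique (Vs (?\<theta> n)) (selection_matrix q)) \<longlonglongrightarrow> row_oblique V (selection_matrix q)"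
    unfolding rows row using \<psi>(4) by (intro tendsto_transpose) simp
  have P: "(\<lambda>n. column_oblique (Us (?\<theta> n)) (selection_matrix p)) \<longlonglongrightarrow> column_oblique U (selection_matrix p)"
    using LIMSEQ_subseq_LIMSEQ[OF \<phi>(4) \<psi>(1)] by (simp add: o_def)
  have "(\<lambda>n. X (?\<theta> n)) \<longlonglongrightarrow> Y"
    using LIMSEQ_subseq_LIMSEQ[OF lim \<theta>] by (simp add: o_def)
  then have FX: "(\<lambda>n. F (X (?\<theta> n))) \<longlonglongrightarrow> F Y"
    using continuous_on_tendsto_compose[OF F] by simp
  have "(\<lambda>n. oblique_combination (column_oblique (Us (?\<theta> n)) (selection_matrix p))
        (row_oblique (Vs (?\<theta> n)) (selection_matrix q)) (F (X (?\<theta> n)))) \<longlonglongrightarrow>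
      oblique_combination (column_oblique U (selection_matrix p)) (row_oblique V (selection_matrix q)) (F Y)"
    unfolding oblique_combination_def by (intro tendsto_intros P P' FX)
  then have "(\<lambda>n. oblique_proj TYPE('r) (X (?\<theta> n)) (F (X (?\<theta> n)))) \<longlonglongrightarrow>
      oblique_combination (column_oblique U (selection_matrix p)) (row_oblique V (selection_matrix q)) (F Y)"
    by (simp add: proj \<phi>(3) \<psi>(3))
  then show thesis
    using \<phi>(3) \<psi>(3) by (intro that[OF \<theta> \<phi>(2) \<psi>(2) X]) simp_all
qed

text \<open>Perturbing on both sides by matrices tending to the identity makes \<open>p\<close> and
  \<open>q\<close> the forced pivots for the column and row space. Any limit supplied by
  \<open>oblique_proj_subsequence\<close> must then come from these selections.\<close>

lemma oblique_proj_limit_attained: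
  fixes F :: "real ^ 'n::{finite,linorder} ^ 'm::{finite,linorder}
              \<Rightarrow> real ^ 'n::{finite,linorder} ^ 'm::{finite,linorder}"
    and U :: "real ^ 'r::{finite,linorder} ^ 'm::{finite,linorder}"
    and V :: "real ^ 'r::{finite,linorder} ^ 'n::{finite,linorder}"
  assumes less: "CARD('r) < CARD('m)" "CARD('r) < CARD('n)"
    and rank: "rank Y = CARD('r)" and Y: "rank_factors Y U V" and F: "continuous_on UNIV F"
    and p: "qdeim_feasible U p" and q: "qdeim_feasible V q"
  obtains X where "X \<longlonglongrightarrow> Y" "\<And>n. rank (X n) = CARD('r)"
    "(\<lambda>n. oblique_proj TYPE('r) (X n) (F (X n))) \<longlonglongrightarrow>
      oblique_combination (column_oblique U (selection_matrix p)) (row_oblique V (selection_matrix q)) (F Y)"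
proof -
  obtain \<Sigma> :: "real ^ 'r::{finite,linorder} ^ 'r::{finite,linorder}"
    where \<Sigma>: "Y = U ** \<Sigma> ** transpose V"
    and U: "orthonormal_columns U" and V: "orthonormal_columns V"
    using Y by (auto simp: rank_factors_def)
  obtain A where A: "A \<longlonglongrightarrow> mat 1" "\<And>n. invertible (A n)"
      "\<And>n. strictly_greedy (range ((*v) (A n ** U))) CARD('r) p"
    by (rule strictly_greedy_perturbation_sequence[OF U less(1) p]) (rule that)
  obtain B where B: "B \<longlonglongrightarrow> mat 1" "\<And>n. invertible (B n)"
      "\<And>n. strictly_greedy (range ((*v) (B n ** V))) CARD('r) q"
    by (rule strictly_greedy_perturbation_sequence[OF V less(2) q]) (rule that)
  define X where "X n = A n ** Y ** transpose (B n)" for n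
  have "X \<longlonglongrightarrow> mat 1 ** Y ** transpose (mat 1)"
    unfolding X_def by (intro tendsto_intros A B)
  then have lim: "X \<longlonglongrightarrow> Y"
    by simp
  have rankX: "rank (X n) = CARD('r)" for n
  proof (rule antisym)
    have "rank (X n) \<le> rank Y"
      unfolding X_def using rank_mul_le_left rank_mul_le_right order_trans by metis
    with rank show "rank (X n) \<le> CARD('r)"
      by simp
    \<comment> \<open>Undoing the invertible factors shows that the perturbation does not lower the
      rank.\<close>
    have "Y = matrix_inv (A n) ** X n ** matrix_inv (transpose (B n))"
    proof -
      have "matrix_inv (A n) ** X n ** matrix_inv (transpose (B n)) =
          (matrix_inv (A n) ** A n) ** Y ** (transpose (B n) ** matrix_inv (transpose (B n)))"
        by (simp only: X_def matrix_mul_assoc)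
      then show ?thesis
        using A(2) B(2) by (simp add: matrix_inv_left matrix_inv_right transpose_invertible)
    qed
    then have "rank Y \<le> rank (X n)"
      using rank_mul_le_left rank_mul_le_right order_trans by metis
    with rank show "CARD('r) \<le> rank (X n)"
      by simp
  qed
  obtain \<phi> p' q' and Us :: "nat \<Rightarrow> real ^ 'r::{finite,linorder} ^ 'm::{finite,linorder}"
    and Vs :: "nat \<Rightarrow> real ^ 'r::{finite,linorder} ^ 'n::{finite,linorder}" where
    \<phi>: "strict_mono \<phi>" "\<And>n. rank_factors (X n) (Us n) (Vs n)"
      "\<And>n. qdeim (Us (\<phi> n)) = selection_matrix p'" "\<And>n. qdeim (Vs (\<phi> n)) = selection_matrix q'"
      "(\<lambda>n. oblique_proj TYPE('r) (X (\<phi> n)) (F (X (\<phi> n)))) \<longlonglongrightarrow>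
        oblique_combination (column_oblique U (selection_matrix p')) (row_oblique V (selection_matrix q')) (F Y)"
    by (rule oblique_proj_subsequence[OF lim rankX rank Y F]) (rule that)
  have "qdeim (Us n) = selection_matrix p" for n
  proof -
    have "X n = (A n ** U) ** (\<Sigma> ** transpose V ** transpose (B n))"
      by (simp only: X_def \<Sigma> matrix_mul_assoc)
    then obtain Q :: "real ^ 'r::{finite,linorder} ^ 'r::{finite,linorder}"
      where Q: "invertible Q" "Us n = (A n ** U) ** Q"
      using rank_factors_basis_change[OF \<phi>(2) rankX] by metis
    then show ?thesis
      using A(3)[of n] \<phi>(2)[of n] range_mult_invertible[OF Q(1), of "A n ** U"]
      by (intro qdeim_eq_if_strictly_greedy) (simp_all add: rank_factors_def)
  qed
  \<comment> \<open>Only selection matrices are compared; \<open>p'\<close> and \<open>p\<close> may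
    differ from step r on.\<close>
  then have p': "selection_matrix p' = (selection_matrix p :: real ^ 'r::{finite,linorder} ^ 'm::{finite,linorder})"
    using \<phi>(3) by metis
  have "qdeim (Vs n) = selection_matrix q" for n
  proof -
    have "transpose (X n) = (B n ** V) ** (transpose \<Sigma> ** transpose U ** transpose (A n))"
      by (simp add: X_def \<Sigma> matrix_mul_assoc matrix_transpose_mul)
    moreover have "rank (transpose (X n)) = CARD('r)"
      by (simp add: rank_transpose rankX)
    ultimately obtain Q :: "real ^ 'r::{finite,linorder} ^ 'r::{finite,linorder}"
      where Q: "invertible Q" "Vs n = (B n ** V) ** Q"
      using rank_factors_basis_change[OF rank_factors_transpose[OF \<phi>(2)]] by metis
    then show ?thesis
      using B(3)[of n] \<phi>(2)[of n] range_mult_invertible[OF Q(1), of "B n ** V"]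
      by (intro qdeim_eq_if_strictly_greedy) (simp_all add: rank_factors_def)
  qed
  then have q': "selection_matrix q' = (selection_matrix q :: real ^ 'r::{finite,linorder} ^ 'n::{finite,linorder})"
    using \<phi>(4) by metis
  show thesis
    using \<phi>(5) LIMSEQ_subseq_LIMSEQ[OF lim \<phi>(1)] rankX unfolding p' q'
    by (intro that[of "X \<circ> \<phi>"]) simp_all
qed

lemma finite_qdeim_selections: "finite (qdeim_selections U)"
proof (rule finite_subset)
  show "qdeim_selections U \<subseteq> range (\<lambda>h. transpose (\<chi> j. axis (h j) 1))"
    by (auto simp: qdeim_selections_def selection_matrix_def)
qed simp

text \<open>The sum of \<open>C\<close> and a closed ball is convex and closed, so it contains the
  closed convex hull of every set it contains.\<close>

lemma closure_hull_approx:
  fixes C :: "'a::euclidean_space set"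
  assumes C: "compact C" "convex C" and approx: "\<And>y. y \<in> S \<Longrightarrow> \<exists>c\<in>C. dist c y \<le> \<delta>"
    and x: "x \<in> closure (convex hull S)"
  shows "\<exists>c\<in>C. dist c x \<le> \<delta>"
proof -
  let ?D = "\<Union>c\<in>C. \<Union>d\<in>cball 0 \<delta>. {c + d}"
  have "S \<subseteq> ?D"
  proof
    fix y assume "y \<in> S"
    then obtain c where "c \<in> C" "dist c y \<le> \<delta>"
      using approx by blast
    then have "c \<in> C" "y - c \<in> cball 0 \<delta>" "y = c + (y - c)"
      by (simp_all add: dist_norm norm_minus_commute)
    then show "y \<in> ?D"
      by blast
  qed
  moreover have "convex ?D"
    using C(2) by (intro convex_sums) auto
  moreover have "closed ?D"
    using C(1) by (intro compact_closed_sums) auto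
  ultimately have "closure (convex hull S) \<subseteq> ?D"
    by (intro closure_minimal hull_minimal)
  then obtain c d where "c \<in> C" "d \<in> cball 0 \<delta>" "x = c + d"
    using x by blast
  then show ?thesis
    by (intro bexI[of _ c]) (simp_all add: dist_norm)
qed

theorem lemma6:
  fixes F :: "real ^ 'n::{finite,linorder} ^ 'm::{finite,linorder}
              \<Rightarrow> real ^ 'n::{finite,linorder} ^ 'm::{finite,linorder}"
    and Y :: "real ^ 'n::{finite,linorder} ^ 'm::{finite,linorder}"
    and U :: "real ^ 'r::{finite,linorder} ^ 'm::{finite,linorder}"
    and \<Sigma> :: "real ^ 'r::{finite,linorder} ^ 'r::{finite,linorder}"
    and V :: "real ^ 'r::{finite,linorder} ^ 'n::{finite,linorder}"
  assumes "CARD('r) < CARD('m)" and "CARD('r) < CARD('n)"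
    and "continuous_on UNIV F" and "\<exists>B. \<forall>X. norm (F X) \<le> B"
    and "Y \<in> fixed_rank CARD('r)"
    and "orthonormal_columns U" and "orthonormal_columns V"
    and "Y = U ** \<Sigma> ** transpose V"
  shows "filippov_map TYPE('r) F Y =
    convex hull {column_oblique U S\<^sub>U ** F Y
                 - column_oblique U S\<^sub>U ** F Y ** row_oblique V S\<^sub>V
                 + F Y ** row_oblique V S\<^sub>V
                | S\<^sub>U S\<^sub>V. S\<^sub>U \<in> qdeim_selections U \<and> S\<^sub>V \<in> qdeim_selections V}"
proof -
  let ?f = "\<lambda>X. oblique_proj TYPE('r) X (F X)"
  let ?N = "\<lambda>\<epsilon>. cball Y \<epsilon> \<inter> fixed_rank CARD('r)"
  define G where "G = (\<lambda>(S, T). oblique_combination (column_oblique U S) (row_oblique V T) (F Y)) `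
    (qdeim_selections U \<times> qdeim_selections V)"
  have rank: "rank Y = CARD('r)"
    using assms by (simp add: fixed_rank_def)
  have Y: "rank_factors Y U V"
    using assms by (auto simp: rank_factors_def)
  have "finite G"
    by (simp add: G_def finite_qdeim_selections)
  then have compact: "compact (convex hull G)"
    by (rule finite_imp_compact_convex_hull)
  have "filippov_map TYPE('r) F Y = convex hull G"
  proof
    show "filippov_map TYPE('r) F Y \<subseteq> convex hull G"
    proof
      fix x assume x: "x \<in> filippov_map TYPE('r) F Y"
      have "\<exists>c\<in>convex hull G. dist c x < \<delta>" if "0 < \<delta>" for \<delta>
      proof -
        \<comment> \<open>Otherwise some sequence of rank r matrices tends to \<open>Y\<close> while
          its images stay away from \<open>G\<close>, although a subsequence of the images converges
          to a point of \<open>G\<close>.\<close>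
        have "\<exists>\<epsilon>>0. \<forall>X\<in>?N \<epsilon>. \<exists>g\<in>G. dist g (?f X) \<le> \<delta> / 2"
        proof (rule ccontr)
          assume contra: "\<not> (\<exists>\<epsilon>>0. \<forall>X\<in>?N \<epsilon>. \<exists>g\<in>G. dist g (?f X) \<le> \<delta> / 2)"
          \<comment> \<open>The radius is halved because the ball is closed while the convergence
            lemma asks for a strict bound.\<close>
          have "\<exists>X\<in>?N (inverse (real (Suc n)) / 2). \<forall>g\<in>G. \<delta> / 2 < dist g (?f X)" for n
          proof -
            have "0 < inverse (real (Suc n)) / 2"
              by simp
            with contra show ?thesis
              by (meson not_le)
          qed
          then obtain X where X: "\<And>n. X n \<in> ?N (inverse (real (Suc n)) / 2)"
              "\<And>n g. g \<in> G \<Longrightarrow> \<delta> / 2 < dist g (?f (X n))"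
            by metis
          have "dist (X n) Y < inverse (real (Suc n))" for n
          proof -
            have "dist (X n) Y \<le> inverse (real (Suc n)) / 2"
              using X(1)[of n] by (simp add: dist_commute)
            also have "\<dots> < inverse (real (Suc n))"
              by simp
            finally show ?thesis .
          qed
          then have lim: "X \<longlonglongrightarrow> Y"
            by (rule tendsto_dist_less_inverse)
          have rankX: "rank (X n) = CARD('r)" for n
            using X(1) by (simp add: fixed_rank_def)
          obtain \<phi> p q where \<phi>: "qdeim_feasible U p" "qdeim_feasible V q"
              "(\<lambda>n. ?f (X (\<phi> n))) \<longlonglongrightarrow> oblique_combination (column_oblique U (selection_matrix p))
                (row_oblique V (selection_matrix q)) (F Y)" (is "_ \<longlonglongrightarrow> ?g")
            by (rule oblique_proj_subsequence[OF lim rankX rank Y assms(3)]) (rule that)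
          have "?g \<in> G"
            using \<phi>(1,2) by (auto simp: G_def qdeim_selections_def)
          moreover have "\<forall>\<^sub>F n in sequentially. dist (?f (X (\<phi> n))) ?g < \<delta> / 2"
            using \<phi>(3) \<open>0 < \<delta>\<close> by (intro tendstoD) auto
          then obtain n where "dist (?f (X (\<phi> n))) ?g < \<delta> / 2"
            using eventually_happens'[OF sequentially_bot] by blast
          ultimately show False
            using X(2)[of ?g "\<phi> n"] by (simp add: dist_commute)
        qed
        then obtain \<epsilon> where \<epsilon>: "0 < \<epsilon>" "\<And>X. X \<in> ?N \<epsilon> \<Longrightarrow> \<exists>g\<in>G. dist g (?f X) \<le> \<delta> / 2"
          by blast
        \<comment> \<open>Closeness to \<open>G\<close> on the generators passes to their closed
          convex hull; as \<delta> is arbitrary, \<open>x\<close> lies in the closed set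
          \<open>convex hull G\<close>.\<close>
        have "\<exists>c\<in>convex hull G. dist c x \<le> \<delta> / 2"
        proof (rule closure_hull_approx[OF compact convex_convex_hull])
          show "x \<in> closure (convex hull (?f ` ?N \<epsilon>))"
            using x \<epsilon>(1) by (simp add: filippov_map_def)
          show "\<exists>c\<in>convex hull G. dist c y \<le> \<delta> / 2" if "y \<in> ?f ` ?N \<epsilon>" for y
            using that \<epsilon>(2) hull_subset[of G convex] by blast
        qed
        with \<open>0 < \<delta>\<close> show ?thesis
          by force
      qed
      then have "x \<in> closure (convex hull G)"
        by (simp add: closure_approachable)
      then show "x \<in> convex hull G"
        using compact by (simp add: compact_imp_closed closure_closed)
    qed
    show "convex hull G \<subseteq> filippov_map TYPE('r) F Y"
      unfolding filippov_map_def
    proof (rule INT_greatest)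
      fix \<epsilon> :: real assume \<epsilon>: "\<epsilon> \<in> {0<..}"
      let ?C = "closure (convex hull (?f ` ?N \<epsilon>))"
      \<comment> \<open>It suffices to reach the points of \<open>G\<close>, since \<open>?C\<close>
        is convex. Each is a limit of images of matrices that eventually lie in the \<epsilon>-ball,
        and \<open>?C\<close> is closed.\<close>
      have "g \<in> ?C" if gG: "g \<in> G" for g
      proof -
        obtain p q where pq: "qdeim_feasible U p" "qdeim_feasible V q"
          and g: "g = oblique_combination (column_oblique U (selection_matrix p))
                (row_oblique V (selection_matrix q)) (F Y)"
          using gG by (auto simp: G_def qdeim_selections_def)
        obtain X where X: "X \<longlonglongrightarrow> Y" "\<And>n. rank (X n) = CARD('r)" "(\<lambda>n. ?f (X n)) \<longlonglongrightarrow> g"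
          unfolding g by (rule oblique_proj_limit_attained[OF assms(1,2) rank Y assms(3) pq])
            (rule that[unfolded g])
        have "\<forall>\<^sub>F n in sequentially. dist (X n) Y < \<epsilon>"
          using X(1) \<epsilon> by (intro tendstoD) auto
        then have "\<forall>\<^sub>F n in sequentially. ?f (X n) \<in> ?C"
        proof eventually_elim
          case (elim n)
          then have "X n \<in> ?N \<epsilon>"
            using X(2) by (simp add: fixed_rank_def dist_commute)
          then show ?case
            using hull_subset[of "?f ` ?N \<epsilon>" convex] closure_subset by blast
        qed
        then show ?thesis
          using Lim_in_closed_set[OF closed_closure _ sequentially_bot X(3)] by blast
      qed
      then show "convex hull G \<subseteq> ?C"
        by (intro hull_minimal convex_closure convex_convex_hull) blast
    qed
  qed
  also have "G = {column_oblique U S\<^sub>U ** F Y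
                 - column_oblique U S\<^sub>U ** F Y ** row_oblique V S\<^sub>V
                 + F Y ** row_oblique V S\<^sub>V
                | S\<^sub>U S\<^sub>V. S\<^sub>U \<in> qdeim_selections U \<and> S\<^sub>V \<in> qdeim_selections V}"
    by (auto simp: G_def oblique_combination_def)
  finally show ?thesis .
qed

end
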